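(* Let $G$ be a locally compact group acting vertex-transitively by automorphisms on a locally finite, infinite tree $X$; let $x$ be a vertex of $X$ and $K=\operatorname{Stab}_G(x)$, a maximal compact subgroup of $G$. Let $T$ be a finite abelian group, $\alpha:G\times G\to T$ a normalized 2-cocycle with $\alpha|_{K\times K}=1$, and $\widetilde G=G\times_\alpha T$. Let $\ell$ be a bi-infinite geodesic line in $X$ containing $x$, let $a\in G$ satisfy $a(\ell)=\ell$ and act on $\ell$ as a translation of length $1$, and let $A=\{a^n : n\in\mathbb Z\}$, $\widetilde A=A\times_\alpha T$. Suppose that $G=KAK$. Let $\xi_+$ and $\xi_-$ be the endpoints of $\ell$ in $\partial X$ that are, respectively, the attracting and repelling fixed points of $a$. Let $\beta=\{a^n\}_{n>0}\subset A$ and let $\widetilde\beta=\{(a^n,t_n)\}_{n>0}\subset\widetilde A$, where $t_n\in T$. Then \[ P^+_{\widetilde\beta}=P^+_\beta\times_\alpha T=\widetilde G_{\xi_+}=G_{\xi_+}\times_\alpha T\subset\widetilde G,\qquad P^-_{\widetilde\beta}=P^-_\beta\times_\alpha T=\widetilde G_{\xi_-}=G_{\xi_-}\times_\alpha T\subset\widetilde G . \] Moreover, $U^\pm_\beta\times_\alpha T$ is a subgroup of $P^\pm_{\widetilde\beta}$.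
   Context: A normalized 2-cocycle is a map $\alpha:G\times G\to T$ with $\alpha(g_1g_2,g_3)\alpha(g_1,g_2)=\alpha(g_1,g_2g_3)\alpha(g_2,g_3)$ and $\alpha(g,1)=\alpha(1,g)=1$. The group $\widetilde G=G\times_\alpha T$ is the set $G\times T$ with multiplication $(g_1,t_1)(g_2,t_2)=(g_1g_2,\alpha(g_1,g_2)t_1t_2)$; for a subgroup $H\le G$, $H\times_\alpha T$ denotes its preimage $\{(h,t):h\in H,\,t\in T\}$ in $\widetilde G$. Standing conventions: $K$ is compact and open in $G$, the identity of $G$ has a neighborhood basis of compact open subgroups $U\le K$ (in particular $G$ is totally disconnected), and $\widetilde G$ is a locally compact topological group for the topology in which the sets $U\times\{1\}$, $U\le K$ compact open, form a neighborhood basis of the identity. For a totally disconnected locally compact group $H$ and a sequence $\gamma=\{h_n\}_{n>0}$ in $H$: $P^+_\gamma=\{h\in H: \{h_n^{-1}hh_n\}_n \text{ is bounded (relatively compact) in } H\}$ and $U^+_\gamma=\{h\in H:\lim_{n\to\infty}h_n^{-1}hh_n=e\}$; $P^-_\gamma$ and $U^-_\gamma$ are defined in the same way using $h_nhh_n^{-1}$. Here $P^\pm_\beta,U^\pm_\beta$ are taken in $G$ and $P^\pm_{\widetilde\beta}$ in $\widetilde G$. $\partial X$ is the set of ends of $X$. $G_{\xi}$ is the stabilizer of the end $\xi\in\partial X$ in $G$. The group $\widetilde G$ acts on a tree $\widetilde X$ defined as follows. Fix a map $\theta:G/K\to G$ with $\theta(y)K=y$, identify $V(X)$ with $G/K$,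 set $\sigma(g,v)=\theta(gv)^{-1}g\theta(v)$ and $\sigma^{(\alpha)}((g,t),v)=\alpha(g\theta(v),\sigma(g,v)^{-1})\,\alpha(g,\theta(v))\,t$. The tree $\widetilde X$ has vertices $v_0$ (identified with $v$) and $v_\rho$ for $v\in V(X)$, $\rho\in T$ (all distinct, $0$ being a symbol not in $T$), with edges joining $v_0,w_0$ whenever $v,w$ are adjacent in $X$, and joining $v_\rho$ to $v_0$ for all $v,\rho$. The action is $(g,t)(v_0)=(gv)_0$ and $(g,t)(v_\rho)=(gv)_{\sigma^{(\alpha)}((g,t),v)\rho}$. Its boundary satisfies $\partial\widetilde X=\partial X$, and $\widetilde G_{\xi}$ denotes the stabilizer in $\widetilde G$ of the end $\xi\in\partial\widetilde X=\partial X$. *)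

theory Defs
  imports "HOL-Analysis.Abstract_Topological_Spaces" "HOL-Analysis.Abstract_Limits"
    "HOL-Algebra.Group_Action"
begin

section \<open>Trees and their ends\<close>

text \<open>
  A simple graph is a vertex set \<open>V\<close> together with an adjacency relation \<open>E\<close>. Replacing \<open>V\<close> by
  \<open>V - F\<close> in \<open>walk\<close> gives the walks that avoid \<open>F\<close>.
\<close>

definition simple_graph :: "'v set \<Rightarrow> ('v \<Rightarrow> 'v \<Rightarrow> bool) \<Rightarrow> bool" where
  "simple_graph V E \<longleftrightarrow> (\<forall>u v. E u v \<longrightarrow> u \<in> V \<and> v \<in> V \<and> u \<noteq> v \<and> E v u)"

definition walk :: "'v set \<Rightarrow> ('v \<Rightarrow> 'v \<Rightarrow> bool) \<Rightarrow> 'v \<Rightarrow> 'v list \<Rightarrow> 'v \<Rightarrow> bool" where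
  "walk V E u p v \<longleftrightarrow> p \<noteq> [] \<and> set p \<subseteq> V \<and> successively E p \<and> hd p = u \<and> last p = v"

definition connected_graph :: "'v set \<Rightarrow> ('v \<Rightarrow> 'v \<Rightarrow> bool) \<Rightarrow> bool" where
  "connected_graph V E \<longleftrightarrow> V \<noteq> {} \<and> (\<forall>u\<in>V. \<forall>v\<in>V. \<exists>p. walk V E u p v)"

definition graph_cycle :: "'v set \<Rightarrow> ('v \<Rightarrow> 'v \<Rightarrow> bool) \<Rightarrow> 'v list \<Rightarrow> bool" where
  "graph_cycle V E p \<longleftrightarrow>
     length p \<ge> 3 \<and> distinct p \<and> set p \<subseteq> V \<and> successively E p \<and> E (last p) (hd p)"

definition tree :: "'v set \<Rightarrow> ('v \<Rightarrow> 'v \<Rightarrow> bool) \<Rightarrow> bool" where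
  "tree V E \<longleftrightarrow> simple_graph V E \<and> connected_graph V E \<and> (\<nexists>p. graph_cycle V E p)"

definition locally_finite_graph :: "'v set \<Rightarrow> ('v \<Rightarrow> 'v \<Rightarrow> bool) \<Rightarrow> bool" where
  "locally_finite_graph V E \<longleftrightarrow> (\<forall>v\<in>V. finite {w. E v w})"

definition graph_dist :: "'v set \<Rightarrow> ('v \<Rightarrow> 'v \<Rightarrow> bool) \<Rightarrow> 'v \<Rightarrow> 'v \<Rightarrow> nat" where
  "graph_dist V E u v = (LEAST n. \<exists>p. walk V E u p v \<and> length p = Suc n)"

definition geodesic_line :: "'v set \<Rightarrow> ('v \<Rightarrow> 'v \<Rightarrow> bool) \<Rightarrow> (int \<Rightarrow> 'v) \<Rightarrow> bool" where
  "geodesic_line V E L \<longleftrightarrow>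
     range L \<subseteq> V \<and> (\<forall>i j. int (graph_dist V E (L i) (L j)) = \<bar>i - j\<bar>)"

definition geodesic_ray :: "'v set \<Rightarrow> ('v \<Rightarrow> 'v \<Rightarrow> bool) \<Rightarrow> (nat \<Rightarrow> 'v) \<Rightarrow> bool" where
  "geodesic_ray V E r \<longleftrightarrow>
     range r \<subseteq> V \<and> (\<forall>i j. int (graph_dist V E (r i) (r j)) = \<bar>int i - int j\<bar>)"

definition cofinal_rays :: "(nat \<Rightarrow> 'v) \<Rightarrow> (nat \<Rightarrow> 'v) \<Rightarrow> bool" where
  "cofinal_rays r s \<longleftrightarrow> (\<exists>m n. \<forall>k. r (m + k) = s (n + k))"

text \<open>An end of a tree is a class of geodesic rays, two rays being equivalent if they share a tail.\<close>

definition end_of :: "'v set \<Rightarrow> ('v \<Rightarrow> 'v \<Rightarrow> bool) \<Rightarrow> (nat \<Rightarrow> 'v) \<Rightarrow> (nat \<Rightarrow> 'v) set" where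
  "end_of V E r = {s. geodesic_ray V E s \<and> cofinal_rays r s}"

definition tree_ends :: "'v set \<Rightarrow> ('v \<Rightarrow> 'v \<Rightarrow> bool) \<Rightarrow> (nat \<Rightarrow> 'v) set set" where
  "tree_ends V E = end_of V E ` {r. geodesic_ray V E r}"

definition line_endpoints :: "'v set \<Rightarrow> ('v \<Rightarrow> 'v \<Rightarrow> bool) \<Rightarrow> (int \<Rightarrow> 'v) \<Rightarrow> (nat \<Rightarrow> 'v) set set" where
  "line_endpoints V E L = {end_of V E (\<lambda>n. L (int n)), end_of V E (\<lambda>n. L (- int n))}"

definition end_action :: "('g \<Rightarrow> 'v \<Rightarrow> 'v) \<Rightarrow> 'g \<Rightarrow> (nat \<Rightarrow> 'v) set \<Rightarrow> (nat \<Rightarrow> 'v) set" where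
  "end_action \<phi> g \<xi> = (\<lambda>r. \<phi> g \<circ> r) ` \<xi>"

text \<open>
  Convergence of a sequence of vertices to an end in the end compactification: for every finite set
  \<open>F\<close> of vertices, the sequence eventually lies in the component of the complement of \<open>F\<close> that
  contains the tails of the rays of \<open>\<xi>\<close>.
\<close>

definition converges_to_end ::
  "'v set \<Rightarrow> ('v \<Rightarrow> 'v \<Rightarrow> bool) \<Rightarrow> (nat \<Rightarrow> 'v) \<Rightarrow> (nat \<Rightarrow> 'v) set \<Rightarrow> bool" where
  "converges_to_end V E s \<xi> \<longleftrightarrow>
     (\<forall>F. finite F \<longrightarrow> (\<forall>r\<in>\<xi>. \<forall>\<^sub>F n in sequentially. \<forall>\<^sub>F m in sequentially.
        \<exists>p. walk (V - F) E (s n) p (r m)))"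

text \<open>
  Attraction is tested on vertices, not on the ends: if the tree is a line, the space of ends is
  discrete with two points and does not distinguish the attracting from the repelling one.
\<close>

definition attracting_end ::
  "'g monoid \<Rightarrow> 'v set \<Rightarrow> ('v \<Rightarrow> 'v \<Rightarrow> bool) \<Rightarrow> ('g \<Rightarrow> 'v \<Rightarrow> 'v) \<Rightarrow> 'g \<Rightarrow> (nat \<Rightarrow> 'v) set \<Rightarrow> bool" where
  "attracting_end G V E \<phi> g \<xi> \<longleftrightarrow>
     \<xi> \<in> tree_ends V E \<and> end_action \<phi> g \<xi> = \<xi> \<and>
     (\<forall>v\<in>V. converges_to_end V E (\<lambda>n. \<phi> (g [^]\<^bsub>G\<^esub> n) v) \<xi>)"

definition repelling_end ::
  "'g monoid \<Rightarrow> 'v set \<Rightarrow> ('v \<Rightarrow> 'v \<Rightarrow> bool) \<Rightarrow> ('g \<Rightarrow> 'v \<Rightarrow> 'v) \<Rightarrow> 'g \<Rightarrow> (nat \<Rightarrow> 'v) set \<Rightarrow> bool" where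
  "repelling_end G V E \<phi> g \<xi> \<longleftrightarrow> attracting_end G V E \<phi> (inv\<^bsub>G\<^esub> g) \<xi>"

text \<open>The sign is left open, so that \<open>L\<close> need not be parametrized in the direction of the translation.\<close>

definition translates_line :: "('g \<Rightarrow> 'v \<Rightarrow> 'v) \<Rightarrow> 'g \<Rightarrow> (int \<Rightarrow> 'v) \<Rightarrow> nat \<Rightarrow> bool" where
  "translates_line \<phi> g L d \<longleftrightarrow> (\<exists>\<epsilon>\<in>{1, -1}. \<forall>i. \<phi> g (L i) = L (i + \<epsilon> * int d))"

definition acts_by_automorphisms ::
  "'g monoid \<Rightarrow> 'v set \<Rightarrow> ('v \<Rightarrow> 'v \<Rightarrow> bool) \<Rightarrow> ('g \<Rightarrow> 'v \<Rightarrow> 'v) \<Rightarrow> bool" where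
  "acts_by_automorphisms G V E \<phi> \<longleftrightarrow>
     group_action G V \<phi> \<and>
     (\<forall>g\<in>carrier G. \<forall>u\<in>V. \<forall>v\<in>V. E (\<phi> g u) (\<phi> g v) \<longleftrightarrow> E u v)"


section \<open>Locally compact groups\<close>

definition locally_compact_group :: "'g monoid \<Rightarrow> 'g topology \<Rightarrow> bool" where
  "locally_compact_group G X \<longleftrightarrow>
     group G \<and> topspace X = carrier G \<and>
     continuous_map (prod_topology X X) X (\<lambda>(g, h). g \<otimes>\<^bsub>G\<^esub> h) \<and>
     continuous_map X X (\<lambda>g. inv\<^bsub>G\<^esub> g) \<and>
     Hausdorff_space X \<and> locally_compact_space X"

definition neighbourhood_basis :: "'a topology \<Rightarrow> 'a \<Rightarrow> 'a set set \<Rightarrow> bool" where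
  "neighbourhood_basis X e \<B> \<longleftrightarrow>
     (\<forall>B\<in>\<B>. B \<subseteq> topspace X \<and> e \<in> X interior_of B) \<and>
     (\<forall>W. openin X W \<and> e \<in> W \<longrightarrow> (\<exists>B\<in>\<B>. B \<subseteq> W))"

definition compact_open_subgroups :: "'g monoid \<Rightarrow> 'g topology \<Rightarrow> 'g set \<Rightarrow> 'g set set" where
  "compact_open_subgroups G X K = {U. subgroup U G \<and> compactin X U \<and> openin X U \<and> U \<subseteq> K}"

definition maximal_compact_subgroup :: "'g monoid \<Rightarrow> 'g topology \<Rightarrow> 'g set \<Rightarrow> bool" where
  "maximal_compact_subgroup G X K \<longleftrightarrow>
     subgroup K G \<and> compactin X K \<and>
     (\<forall>H. subgroup H G \<and> compactin X H \<and> K \<subseteq> H \<longrightarrow> H = K)"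

definition relatively_compact :: "'a topology \<Rightarrow> 'a set \<Rightarrow> bool" where
  "relatively_compact X S \<longleftrightarrow> compactin X (X closure_of S)"

text \<open>Sequences are indexed by \<open>n > 0\<close>; the value at \<open>0\<close> is irrelevant.\<close>

definition P_plus :: "'g monoid \<Rightarrow> 'g topology \<Rightarrow> (nat \<Rightarrow> 'g) \<Rightarrow> 'g set" where
  "P_plus H X \<gamma> = {h \<in> carrier H.
     relatively_compact X {inv\<^bsub>H\<^esub> (\<gamma> n) \<otimes>\<^bsub>H\<^esub> h \<otimes>\<^bsub>H\<^esub> \<gamma> n |n. n > 0}}"

definition P_minus :: "'g monoid \<Rightarrow> 'g topology \<Rightarrow> (nat \<Rightarrow> 'g) \<Rightarrow> 'g set" where
  "P_minus H X \<gamma> = {h \<in> carrier H.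
     relatively_compact X {\<gamma> n \<otimes>\<^bsub>H\<^esub> h \<otimes>\<^bsub>H\<^esub> inv\<^bsub>H\<^esub> (\<gamma> n) |n. n > 0}}"

definition U_plus :: "'g monoid \<Rightarrow> 'g topology \<Rightarrow> (nat \<Rightarrow> 'g) \<Rightarrow> 'g set" where
  "U_plus H X \<gamma> = {h \<in> carrier H.
     limitin X (\<lambda>n. inv\<^bsub>H\<^esub> (\<gamma> n) \<otimes>\<^bsub>H\<^esub> h \<otimes>\<^bsub>H\<^esub> \<gamma> n) \<one>\<^bsub>H\<^esub> sequentially}"

definition U_minus :: "'g monoid \<Rightarrow> 'g topology \<Rightarrow> (nat \<Rightarrow> 'g) \<Rightarrow> 'g set" where
  "U_minus H X \<gamma> = {h \<in> carrier H.
     limitin X (\<lambda>n. \<gamma> n \<otimes>\<^bsub>H\<^esub> h \<otimes>\<^bsub>H\<^esub> inv\<^bsub>H\<^esub> (\<gamma> n)) \<one>\<^bsub>H\<^esub> sequentially}"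


section \<open>The extension and its tree\<close>

definition normalized_cocycle :: "'g monoid \<Rightarrow> 't monoid \<Rightarrow> ('g \<Rightarrow> 'g \<Rightarrow> 't) \<Rightarrow> bool" where
  "normalized_cocycle G T \<alpha> \<longleftrightarrow>
     (\<forall>g\<in>carrier G. \<forall>h\<in>carrier G. \<alpha> g h \<in> carrier T) \<and>
     (\<forall>g1\<in>carrier G. \<forall>g2\<in>carrier G. \<forall>g3\<in>carrier G.
        \<alpha> (g1 \<otimes>\<^bsub>G\<^esub> g2) g3 \<otimes>\<^bsub>T\<^esub> \<alpha> g1 g2 = \<alpha> g1 (g2 \<otimes>\<^bsub>G\<^esub> g3) \<otimes>\<^bsub>T\<^esub> \<alpha> g2 g3) \<and>
     (\<forall>g\<in>carrier G. \<alpha> g \<one>\<^bsub>G\<^esub> = \<one>\<^bsub>T\<^esub> \<and> \<alpha> \<one>\<^bsub>G\<^esub> g = \<one>\<^bsub>T\<^esub>)"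

text \<open>
  The preimage in the extension of a subset \<open>H\<close> of \<open>carrier G\<close> is written \<open>H \<times> carrier T\<close>.
\<close>

definition cocycle_extension :: "'g monoid \<Rightarrow> 't monoid \<Rightarrow> ('g \<Rightarrow> 'g \<Rightarrow> 't) \<Rightarrow> ('g \<times> 't) monoid" where
  "cocycle_extension G T \<alpha> =
     \<lparr>carrier = carrier G \<times> carrier T,
      mult = (\<lambda>(g1, t1) (g2, t2). (g1 \<otimes>\<^bsub>G\<^esub> g2, \<alpha> g1 g2 \<otimes>\<^bsub>T\<^esub> t1 \<otimes>\<^bsub>T\<^esub> t2)),
      one = (\<one>\<^bsub>G\<^esub>, \<one>\<^bsub>T\<^esub>)\<rparr>"

text \<open>
  The identification of \<open>V\<close> with \<open>G/K\<close> sends the vertex \<open>g x\<close> to the coset \<open>g K\<close>, so a map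
  \<open>\<theta> : G/K \<rightarrow> G\<close> with \<open>\<theta>(y) K = y\<close> becomes a map on vertices with \<open>\<theta>(v) x = v\<close>.
\<close>

definition vertex_section ::
  "'g monoid \<Rightarrow> 'v set \<Rightarrow> ('g \<Rightarrow> 'v \<Rightarrow> 'v) \<Rightarrow> 'v \<Rightarrow> ('v \<Rightarrow> 'g) \<Rightarrow> bool" where
  "vertex_section G V \<phi> x \<theta> \<longleftrightarrow> (\<forall>v\<in>V. \<theta> v \<in> carrier G \<and> \<phi> (\<theta> v) x = v)"

definition sigma :: "'g monoid \<Rightarrow> ('g \<Rightarrow> 'v \<Rightarrow> 'v) \<Rightarrow> ('v \<Rightarrow> 'g) \<Rightarrow> 'g \<Rightarrow> 'v \<Rightarrow> 'g" where
  "sigma G \<phi> \<theta> g v = inv\<^bsub>G\<^esub> (\<theta> (\<phi> g v)) \<otimes>\<^bsub>G\<^esub> g \<otimes>\<^bsub>G\<^esub> \<theta> v"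

definition sigma_ext ::
  "'g monoid \<Rightarrow> 't monoid \<Rightarrow> ('g \<Rightarrow> 'g \<Rightarrow> 't) \<Rightarrow> ('g \<Rightarrow> 'v \<Rightarrow> 'v) \<Rightarrow> ('v \<Rightarrow> 'g)
   \<Rightarrow> 'g \<times> 't \<Rightarrow> 'v \<Rightarrow> 't" where
  "sigma_ext G T \<alpha> \<phi> \<theta> = (\<lambda>(g, t) v.
     \<alpha> (g \<otimes>\<^bsub>G\<^esub> \<theta> v) (inv\<^bsub>G\<^esub> (sigma G \<phi> \<theta> g v)) \<otimes>\<^bsub>T\<^esub> \<alpha> g (\<theta> v) \<otimes>\<^bsub>T\<^esub> t)"

text \<open>
  The vertex \<open>v\<^sub>0\<close> is encoded as \<open>(v, None)\<close> and \<open>v\<^sub>\<rho>\<close> as \<open>(v, Some \<rho>)\<close>.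
\<close>

definition ext_verts :: "'v set \<Rightarrow> 't monoid \<Rightarrow> ('v \<times> 't option) set" where
  "ext_verts V T = V \<times> ({None} \<union> Some ` carrier T)"

definition ext_adj ::
  "'v set \<Rightarrow> ('v \<Rightarrow> 'v \<Rightarrow> bool) \<Rightarrow> 't monoid \<Rightarrow> 'v \<times> 't option \<Rightarrow> 'v \<times> 't option \<Rightarrow> bool" where
  "ext_adj V E T a b \<longleftrightarrow>
     (\<exists>v w. E v w \<and> a = (v, None) \<and> b = (w, None)) \<or>
     (\<exists>v\<in>V. \<exists>\<rho>\<in>carrier T. a = (v, Some \<rho>) \<and> b = (v, None) \<or> a = (v, None) \<and> b = (v, Some \<rho>))"

definition ext_action ::
  "'g monoid \<Rightarrow> 't monoid \<Rightarrow> ('g \<Rightarrow> 'g \<Rightarrow> 't) \<Rightarrow> ('g \<Rightarrow> 'v \<Rightarrow> 'v) \<Rightarrow> ('v \<Rightarrow> 'g)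
   \<Rightarrow> 'g \<times> 't \<Rightarrow> 'v \<times> 't option \<Rightarrow> 'v \<times> 't option" where
  "ext_action G T \<alpha> \<phi> \<theta> gt = (\<lambda>(v, l).
     (\<phi> (fst gt) v, map_option (\<lambda>\<rho>. sigma_ext G T \<alpha> \<phi> \<theta> gt v \<otimes>\<^bsub>T\<^esub> \<rho>) l))"

text \<open>
  The identification of the ends of the original tree with those of the extended one: the class of
  a ray \<open>r\<close> goes to the class of \<open>n \<mapsto> (r n)\<^sub>0\<close>.
\<close>

definition ext_end ::
  "'v set \<Rightarrow> ('v \<Rightarrow> 'v \<Rightarrow> bool) \<Rightarrow> 't monoid \<Rightarrow> (nat \<Rightarrow> 'v) set \<Rightarrow> (nat \<Rightarrow> 'v \<times> 't option) set" where
  "ext_end V E T \<xi> = (\<Union>r\<in>\<xi>. end_of (ext_verts V T) (ext_adj V E T) (\<lambda>n. (r n, None)))"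

end

theory Submission
  imports Defs
begin

text \<open>
  A subset of a topological group with a compact neighbourhood \<open>C\<close> of the identity is relatively
  compact iff finitely many left cosets of \<open>C\<close> cover it. With \<open>C = K\<close>, boundedness of
  \<open>a\<^sup>-\<^sup>n h a\<^sup>n\<close> says that \<open>d(h a\<^sup>n x, a\<^sup>n x)\<close> is bounded, and in a tree two rays at bounded
  distance share a tail; conversely, if \<open>h a\<^sup>m\<^sup>+\<^sup>k x = a\<^sup>n\<^sup>+\<^sup>k x\<close> for all \<open>k\<close>, then
  \<open>a\<^sup>-\<^sup>j h a\<^sup>j\<close> lies in \<open>a\<^sup>n\<^sup>-\<^sup>m K\<close> for \<open>j \<ge> m\<close>. In the extension \<open>C = K \<times> {1}\<close> works,
  whose cosets project onto those of \<open>K\<close> with finite fibres. An element \<open>(g, t)\<close> acts on the core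
  of the extended tree as \<open>g\<close> does on the original one, so it fixes the same ends. The
  statement for \<open>P\<^sup>-\<close> is the one for \<open>P\<^sup>+\<close> with \<open>a\<close> replaced by its inverse.
\<close>

section \<open>Walks and distances\<close>

lemma walk_map:
  assumes "walk V E u p v" "\<And>y z. E y z \<Longrightarrow> E' (f y) (f z)" "f ` V \<subseteq> V'"
  shows "walk V' E' (f u) (map f p) (f v)"
proof -
  have "successively (\<lambda>y z. E' (f y) (f z)) p"
    by (rule successively_mono[of E]) (use assms(1,2) in \<open>auto simp: walk_def\<close>)
  then show ?thesis
    using assms(1,3) by (auto simp: walk_def successively_map hd_map last_map)
qed

lemma walk_prefix:
  assumes "walk V E u (q @ z # q') v"
  shows "walk V E u (q @ [z]) z"
proof -
  have "successively E (q @ [z])" "set (q @ [z]) \<subseteq> V"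
    using assms by (auto simp: walk_def successively_append_iff)
  moreover have "hd (q @ [z]) = u"
    using assms by (auto simp: walk_def hd_append)
  ultimately show ?thesis by (simp add: walk_def)
qed

text \<open>The projection of the extended tree onto the original one collapses the pendant edges,
  so \<open>f\<close> is allowed to identify the ends of an edge. A collapsed edge shortens the
  walk; hence only an inequality of lengths.\<close>

lemma walk_weak_map:
  assumes "walk V E u p v" "\<And>y z. E y z \<Longrightarrow> f y = f z \<or> E' (f y) (f z)" "f ` V \<subseteq> V'"
  shows "\<exists>q. walk V' E' (f u) q (f v) \<and> length q \<le> length p"
  using assms(1)
proof (induction p arbitrary: u)
  case Nil
  then show ?case by (simp add: walk_def)
next
  case (Cons y p)
  show ?case
  proof (cases p)
    case Nil
    with Cons.prems have "walk V' E' (f u) [f u] (f v)"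
      using assms(3) by (auto simp: walk_def)
    then show ?thesis by (auto simp: Nil)
  next
    case (Cons z p')
    with Cons.prems have "walk V E z p v" and yu: "y = u" "E u z" "u \<in> V"
      by (auto simp: walk_def)
    from Cons.IH[OF this(1)] obtain q where q: "walk V' E' (f z) q (f v)" "length q \<le> length p"
      by blast
    show ?thesis
    proof (cases "f u = f z")
      case True
      with q show ?thesis by (auto intro!: exI[of _ q])
    next
      case False
      with assms(2)[OF yu(2)] q yu(3) assms(3) have "walk V' E' (f u) (f u # q) (f v)"
        by (cases q) (auto simp: walk_def)
      with q show ?thesis by (auto intro!: exI[of _ "f u # q"])
    qed
  qed
qed

lemma graph_dist_le: "walk V E u p v \<Longrightarrow> graph_dist V E u v \<le> length p - 1"
  unfolding graph_dist_def by (rule Least_le) (auto simp: walk_def intro!: exI[of _ p])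

text \<open>The \<open>LEAST\<close> in \<open>graph_dist\<close> is informative only if some length
  occurs at all; any walk is a witness for that.\<close>

lemma graph_dist_walk:
  assumes "walk V E u p v"
  obtains q where "walk V E u q v" "length q = Suc (graph_dist V E u v)"
proof -
  have "\<exists>n q. walk V E u q v \<and> length q = Suc n"
    using assms by (auto simp: walk_def intro!: exI[of _ "length p - 1"] exI[of _ p])
  from LeastI_ex[OF this] show ?thesis
    using that unfolding graph_dist_def by blast
qed

lemma graph_dist_weak_map:
  assumes "walk V E u p v" "\<And>y z. E y z \<Longrightarrow> f y = f z \<or> E' (f y) (f z)" "f ` V \<subseteq> V'"
  shows "graph_dist V' E' (f u) (f v) \<le> graph_dist V E u v"
proof -
  from graph_dist_walk[OF assms(1)] obtain p' where
    p': "walk V E u p' v" "length p' = Suc (graph_dist V E u v)" .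
  from walk_weak_map[OF this(1) assms(2,3)] obtain q where
    q: "walk V' E' (f u) q (f v)" "length q \<le> length p'" by blast
  from graph_dist_le[OF q(1)] q(2) p'(2) show ?thesis by simp
qed

lemma graph_dist_refl: "u \<in> V \<Longrightarrow> graph_dist V E u u = 0"
  using graph_dist_le[of V E u "[u]" u] by (auto simp: walk_def)

section \<open>Graph automorphisms and geodesic rays\<close>

text \<open>Formulated for a single map, so that each element acting on the extended tree can be
  treated without setting up a group action on that tree. Values outside \<open>V\<close> are left
  free, which is why the inverse is taken as \<open>inv_into V f\<close>.\<close>

definition graph_automorphism :: "'v set \<Rightarrow> ('v \<Rightarrow> 'v \<Rightarrow> bool) \<Rightarrow> ('v \<Rightarrow> 'v) \<Rightarrow> bool" where
  "graph_automorphism V E f \<longleftrightarrow>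
     bij_betw f V V \<and> (\<forall>u\<in>V. \<forall>v\<in>V. E (f u) (f v) \<longleftrightarrow> E u v)"

lemma graph_automorphism_inv:
  assumes "graph_automorphism V E f"
  shows "graph_automorphism V E (inv_into V f)"
  using assms unfolding graph_automorphism_def
  by (metis bij_betw_def bij_betw_inv_into f_inv_into_f inv_into_into)

lemma graph_automorphism_walk:
  assumes "graph_automorphism V E f" "walk V E u p v"
  shows "walk V E (f u) (map f p) (f v)"
proof -
  \<comment> \<open>Adjacency is preserved only between vertices of \<open>V\<close>, so membership
    in \<open>V\<close> is built into the relation before the walk is mapped.\<close>
  have "walk V (\<lambda>y z. y \<in> V \<and> z \<in> V \<and> E y z) u p v"
    using assms(2) successively_mono[of E p "\<lambda>y z. y \<in> V \<and> z \<in> V \<and> E y z"]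
    by (auto simp: walk_def)
  then show ?thesis
    by (rule walk_map) (use assms(1) in \<open>auto simp: graph_automorphism_def bij_betw_def\<close>)
qed

lemma graph_automorphism_dist:
  assumes f: "graph_automorphism V E f" and "u \<in> V" "v \<in> V"
  shows "graph_dist V E (f u) (f v) = graph_dist V E u v"
proof -
  have inv: "inv_into V f (f w) = w" if "w \<in> V" for w
    using f that by (simp add: graph_automorphism_def bij_betw_def)
  \<comment> \<open>\<open>f\<close> and its inverse carry walks in both directions without changing
    their lengths, so the two minima range over the same lengths.\<close>
  have "(\<exists>p. walk V E (f u) p (f v) \<and> length p = Suc n) \<longleftrightarrow> (\<exists>p. walk V E u p v \<and> length p = Suc n)" for n
    using graph_automorphism_walk[OF f, of u _ v]
      graph_automorphism_walk[OF graph_automorphism_inv[OF f], of "f u" _ "f v"]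
    by (metis assms(2,3) inv length_map)
  then show ?thesis by (simp add: graph_dist_def)
qed

lemma graph_automorphism_ray:
  assumes "graph_automorphism V E f" "geodesic_ray V E r"
  shows "geodesic_ray V E (f \<circ> r)"
proof -
  have "r n \<in> V" for n using assms(2) by (auto simp: geodesic_ray_def)
  then show ?thesis
    using assms graph_automorphism_dist[OF assms(1)]
    by (auto simp: geodesic_ray_def graph_automorphism_def bij_betw_def)
qed

lemma geodesic_ray_mem: "geodesic_ray V E r \<Longrightarrow> r n \<in> V"
  by (auto simp: geodesic_ray_def)

lemma geodesic_ray_dist: "geodesic_ray V E r \<Longrightarrow> int (graph_dist V E (r i) (r j)) = \<bar>int i - int j\<bar>"
  by (auto simp: geodesic_ray_def)

lemma geodesic_ray_inj:
  assumes "geodesic_ray V E r" "r i = r j"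
  shows "i = j"
  using geodesic_ray_dist[OF assms(1), of i j] geodesic_ray_mem[OF assms(1), of j] assms(2)
  by (simp add: graph_dist_refl)

text \<open>Rays are defined by distances alone. A walk realising the distance 1 has two vertices
  and is thus an edge; connectedness guarantees that the distance is realised.\<close>

lemma geodesic_ray_adj:
  assumes "connected_graph V E" "geodesic_ray V E r"
  shows "E (r i) (r (Suc i))"
proof -
  have V: "r i \<in> V" "r (Suc i) \<in> V" using geodesic_ray_mem[OF assms(2)] by auto
  then obtain p where "walk V E (r i) p (r (Suc i))"
    using assms(1) by (auto simp: connected_graph_def)
  then obtain q where q: "walk V E (r i) q (r (Suc i))"
    "length q = Suc (graph_dist V E (r i) (r (Suc i)))"
    by (rule graph_dist_walk)
  moreover have "graph_dist V E (r i) (r (Suc i)) = 1"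
    using geodesic_ray_dist[OF assms(2), of i "Suc i"] by simp
  ultimately obtain y z where "q = [y, z]" by (auto simp: length_Suc_conv)
  with q(1) show ?thesis by (auto simp: walk_def)
qed

section \<open>Rays in trees\<close>

lemma cofinal_refl: "cofinal_rays r r"
  unfolding cofinal_rays_def by blast

lemma cofinal_sym: "cofinal_rays r s \<Longrightarrow> cofinal_rays s r"
  unfolding cofinal_rays_def by metis

lemma cofinal_trans:
  assumes "cofinal_rays r s" "cofinal_rays s t"
  shows "cofinal_rays r t"
proof -
  from assms obtain m n m' n' where
    "\<And>k. r (m + k) = s (n + k)" "\<And>k. s (m' + k) = t (n' + k)"
    unfolding cofinal_rays_def by blast
  \<comment> \<open>Both tails of \<open>s\<close> are shortened so that they start at
    \<open>n + m'\<close>.\<close>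
  then have "r (m + m' + k) = t (n' + n + k)" for k
    by (metis add.assoc add.left_commute)
  then show ?thesis unfolding cofinal_rays_def by blast
qed

lemma cofinal_map: "cofinal_rays r s \<Longrightarrow> cofinal_rays (f \<circ> r) (f \<circ> s)"
  unfolding cofinal_rays_def comp_def by metis

lemma end_of_eq_iff:
  assumes "geodesic_ray V E r" "geodesic_ray V E s"
  shows "end_of V E r = end_of V E s \<longleftrightarrow> cofinal_rays r s"
  using assms cofinal_refl cofinal_sym cofinal_trans unfolding end_of_def by blast

section \<open>Separation of a tree by a single vertex\<close>

text \<open>For vertices other than \<open>w\<close> this says that they lie in the same component
  after deletion of \<open>w\<close>. The closure makes detours easy to concatenate; explicit walks
  are recovered from it only to exhibit a cycle.\<close>

definition joined_off :: "('v \<Rightarrow> 'v \<Rightarrow> bool) \<Rightarrow> 'v \<Rightarrow> 'v \<Rightarrow> 'v \<Rightarrow> bool" where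
  "joined_off E w = (\<lambda>u v. E u v \<and> u \<noteq> w \<and> v \<noteq> w)\<^sup>*\<^sup>*"

lemma joined_off_trans: "joined_off E w u v \<Longrightarrow> joined_off E w v z \<Longrightarrow> joined_off E w u z"
  unfolding joined_off_def by simp

lemma joined_off_sym:
  assumes "simple_graph V E" "joined_off E w u v"
  shows "joined_off E w v u"
proof -
  have "symp (\<lambda>u v. E u v \<and> u \<noteq> w \<and> v \<noteq> w)"
    using assms(1) by (auto simp: simple_graph_def symp_def)
  then show ?thesis using assms(2) unfolding joined_off_def
    by (rule sympD[OF symp_rtranclp])
qed

lemma walk_joined_off:
  assumes "walk V E u p v" "w \<notin> set p"
  shows "joined_off E w u v"
  using assms
proof (induction p arbitrary: u)
  case Nil
  then show ?case by (simp add: walk_def)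
next
  case (Cons y p)
  show ?case
  proof (cases p)
    case Nil
    with Cons.prems show ?thesis by (auto simp: walk_def joined_off_def)
  next
    case (Cons z p')
    with Cons.prems have "walk V E z p v" "E u z" "u \<noteq> w" "z \<noteq> w"
      by (auto simp: walk_def)
    with Cons.IH[of z] Cons.prems show ?thesis
      by (auto simp: joined_off_def intro: converse_rtranclp_into_rtranclp)
  qed
qed

text \<open>Loop erasure by induction on the chain: a new vertex that already lies on the walk cuts
  the walk off there, and otherwise it is appended. Distinctness is what a cycle will
  require.\<close>

lemma joined_off_walk:
  assumes "simple_graph V E" "joined_off E w u v" "u \<in> V" "u \<noteq> w"
  shows "\<exists>p. walk V E u p v \<and> distinct p \<and> w \<notin> set p"
  using assms(2) unfolding joined_off_def
proof (induction rule: rtranclp_induct)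
  case base
  show ?case using assms by (intro exI[of _ "[u]"]) (auto simp: walk_def)
next
  case (step y z)
  then obtain p where p: "walk V E u p y" "distinct p" "w \<notin> set p" by blast
  show ?case
  proof (cases "z \<in> set p")
    case True
    then obtain q q' where q: "p = q @ z # q'"
      using split_list[OF True] by blast
    then have "walk V E u (q @ [z]) z"
      using p(1) walk_prefix by metis
    moreover have "distinct (q @ [z])" "w \<notin> set (q @ [z])"
      using p(2,3) by (auto simp: q)
    ultimately show ?thesis by blast
  next
    case False
    have "z \<in> V" using step.hyps assms(1) by (auto simp: simple_graph_def)
    with False p step.hyps have "walk V E u (p @ [z]) z" "distinct (p @ [z])" "w \<notin> set (p @ [z])"
      by (auto simp: walk_def successively_append_iff)
    then show ?thesis by blast
  qed
qed

text \<open>A simple walk from \<open>b\<close> to \<open>c\<close> that misses their common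
  neighbour \<open>w\<close> closes up through \<open>w\<close> to a cycle.\<close>

lemma tree_neighbours_not_joined:
  assumes "tree V E" "E w b" "E w c" "joined_off E w b c"
  shows "b = c"
proof (rule ccontr)
  assume "b \<noteq> c"
  have simple: "simple_graph V E" using assms(1) by (simp add: tree_def)
  then have "b \<in> V" "b \<noteq> w" "w \<in> V" "E c w"
    using assms(2,3) by (auto simp: simple_graph_def)
  with joined_off_walk[OF simple assms(4)] obtain p where
    p: "walk V E b p c" "distinct p" "w \<notin> set p" by blast
  \<comment> \<open>Together with \<open>w\<close> this gives the three vertices that a cycle must
    have.\<close>
  have "length p \<ge> 2" using p(1) \<open>b \<noteq> c\<close>
    by (cases p rule: list.exhaust; cases "tl p") (auto simp: walk_def)
  then have "graph_cycle V E (w # p)"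
    using p \<open>w \<in> V\<close> \<open>E c w\<close> assms(2)
    by (cases p) (auto simp: graph_cycle_def walk_def)
  with assms(1) show False by (auto simp: tree_def)
qed

text \<open>By injectivity the ray visits \<open>r i\<close> only at time \<open>i\<close>, and the
  segment from \<open>j\<close> to \<open>k\<close> lies entirely before or entirely after that
  time.\<close>

lemma geodesic_ray_joined_off:
  assumes "connected_graph V E" "geodesic_ray V E r" "j \<le> k" "k < i \<or> i < j"
  shows "joined_off E (r i) (r j) (r k)"
  using assms(3,4)
proof (induction k rule: dec_induct)
  case base
  then show ?case by (simp add: joined_off_def)
next
  case (step k)
  have "k \<noteq> i" "Suc k \<noteq> i" using step by auto
  then have "r k \<noteq> r i" "r (Suc k) \<noteq> r i"
    using geodesic_ray_inj[OF assms(2)] by blast+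
  with step geodesic_ray_adj[OF assms(1,2), of k] show ?case
    by (auto simp: joined_off_def intro: rtranclp.rtrancl_into_rtrancl)
qed

text \<open>Otherwise the two neighbours of \<open>r i\<close> on the ray, each joined along the ray
  to its own side, would be joined off \<open>r i\<close>. In a tree they would then coincide,
  against injectivity of the ray.\<close>

lemma geodesic_ray_separated:
  assumes "tree V E" "geodesic_ray V E r" "j < i" "i < k"
  shows "\<not> joined_off E (r i) (r j) (r k)"
proof
  assume joined: "joined_off E (r i) (r j) (r k)"
  have simple: "simple_graph V E" and conn: "connected_graph V E"
    using assms(1) by (auto simp: tree_def)
  obtain i' where i': "i = Suc i'" using assms(3) by (cases i) auto
  have "joined_off E (r i) (r j) (r i')"
    using assms i' by (intro geodesic_ray_joined_off[OF conn assms(2)]) auto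
  moreover have "joined_off E (r i) (r (Suc i)) (r k)"
    using assms by (intro geodesic_ray_joined_off[OF conn assms(2)]) auto
  ultimately have "joined_off E (r i) (r i') (r (Suc i))"
    using joined joined_off_sym[OF simple] joined_off_trans by metis
  moreover have "E (r i) (r i')" "E (r i) (r (Suc i))"
    using geodesic_ray_adj[OF conn assms(2)] simple i' by (auto simp: simple_graph_def)
  ultimately have "r i' = r (Suc i)"
    using tree_neighbours_not_joined[OF assms(1)] by blast
  then show False using geodesic_ray_inj[OF assms(2)] i' by fastforce
qed

lemma nat_isometry_translation:
  fixes f :: "nat \<Rightarrow> nat"
  assumes "\<And>i j. \<bar>int (f i) - int (f j)\<bar> = \<bar>int i - int j\<bar>"
  shows "f k = f 0 + k"
proof -
  \<comment> \<open>\<open>K\<close> exceeds both \<open>f 0\<close> and \<open>k\<close>. The value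
    \<open>f K\<close> is at distance \<open>K\<close> from \<open>f 0\<close> and cannot lie below
    it, so it lies above; its distance to \<open>f k\<close> then settles on which side of
    \<open>f 0\<close> the value \<open>f k\<close> is.\<close>
  define K where "K = k + f 0 + 1"
  have "\<bar>int (f K) - int (f 0)\<bar> = int K" "\<bar>int (f K) - int (f k)\<bar> = int K - int k"
    "\<bar>int (f k) - int (f 0)\<bar> = int k"
    using assms[of K 0] assms[of K k] assms[of k 0] by (auto simp: K_def)
  then show ?thesis unfolding K_def by linarith
qed

text \<open>
  Closing up the rays with a walk from \<open>r 0\<close> to \<open>s 0\<close> and a short walk from a far \<open>r j\<close> to \<open>s j\<close>
  produces a detour around each \<open>r i\<close> in between, so that \<open>r i\<close> has to lie on \<open>s\<close>.
\<close>
lemma bounded_distance_cofinal: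
  assumes tree: "tree V E" and r: "geodesic_ray V E r" and s: "geodesic_ray V E s"
    and bound: "\<And>n. graph_dist V E (r n) (s n) \<le> C"
  shows "cofinal_rays r s"
proof -
  have simple: "simple_graph V E" and conn: "connected_graph V E"
    using tree by (auto simp: tree_def)
  note V = geodesic_ray_mem[OF r] geodesic_ray_mem[OF s]
  have walk_ex: "\<exists>p. walk V E u p v" if "u \<in> V" "v \<in> V" for u v
    using conn that by (auto simp: connected_graph_def)
  obtain w where w: "walk V E (r 0) w (s 0)" using walk_ex V by blast
  \<comment> \<open>The ray is injective and meets the finite walk \<open>w\<close> only finitely
    often; from index \<open>N\<close> on it avoids \<open>w\<close>.\<close>
  have "finite (r -` set w)"
    by (rule finite_vimageI) (auto intro!: injI geodesic_ray_inj[OF r])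
  then obtain N where N: "\<And>i. r i \<in> set w \<Longrightarrow> i < N"
    by (metis bounded_nat_set_is_finite finite_nat_set_iff_bounded vimageI)
  have on_s: "r i \<in> range s" if i: "i \<ge> Suc N" for i
  proof (rule ccontr)
    assume off: "r i \<notin> range s"
    \<comment> \<open>The vertex \<open>r j\<close> is at distance \<open>C + 1\<close> from
      \<open>r i\<close>, so a shortest walk from \<open>r j\<close> to \<open>s j\<close>, of
      length at most \<open>C\<close>, cannot pass through \<open>r i\<close>.\<close>
    define j where "j = i + C + 1"
    obtain q where q: "walk V E (r j) q (s j)" "length q = Suc (graph_dist V E (r j) (s j))"
      using walk_ex[of "r j" "s j"] V graph_dist_walk by metis
    have "r i \<notin> set q"
    proof
      assume "r i \<in> set q"
      then obtain q1 q2 where q12: "q = q1 @ r i # q2"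
        using split_list[OF \<open>r i \<in> set q\<close>] by blast
      with q(1) have "walk V E (r j) (q1 @ [r i]) (r i)"
        using walk_prefix by metis
      from graph_dist_le[OF this] have "graph_dist V E (r j) (r i) \<le> C"
        using q(2) q12 bound[of j] by simp
      with geodesic_ray_dist[OF r, of j i] show False by (simp add: j_def)
    qed
    then have "joined_off E (r i) (r j) (s j)" using walk_joined_off q(1) by metis
    moreover have "joined_off E (r i) (r 0) (s 0)"
      using walk_joined_off[OF w] N i by (metis Suc_leD not_less)
    moreover have "joined_off E (r i) (s 0) (s j)"
      unfolding joined_off_def
    proof (induction j)
      case (Suc j)
      have "s j \<noteq> r i" "s (Suc j) \<noteq> r i" using off by (metis rangeI)+
      with Suc geodesic_ray_adj[OF conn s, of j] show ?case
        by (auto intro: rtranclp.rtrancl_into_rtrancl)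
    qed simp
    ultimately have "joined_off E (r i) (r 0) (r j)"
      using joined_off_sym[OF simple] joined_off_trans by metis
    moreover have "0 < i" "i < j" using i by (auto simp: j_def)
    ultimately show False using geodesic_ray_separated[OF tree r] by blast
  qed
  \<comment> \<open>The positions on \<open>s\<close> of the vertices of the tail of
    \<open>r\<close> form an isometric map of the natural numbers, hence a shift, and this is
    cofinality.\<close>
  then have "\<exists>f. \<forall>k. r (Suc N + k) = s (f k)"
    by (intro choice) (metis le_add1 rangeE)
  then obtain f where f: "\<And>k. r (Suc N + k) = s (f k)" by blast
  have "\<bar>int (f i) - int (f j)\<bar> = \<bar>int i - int j\<bar>" for i j
    using geodesic_ray_dist[OF r, of "Suc N + i" "Suc N + j"] geodesic_ray_dist[OF s, of "f i" "f j"]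
    by (simp add: f del: add_Suc)
  then have "f k = f 0 + k" for k by (rule nat_isometry_translation)
  then have "r (Suc N + k) = s (f 0 + k)" for k by (metis f)
  then show ?thesis unfolding cofinal_rays_def by blast
qed

section \<open>Rays on a geodesic line\<close>

lemma geodesic_line_ray:
  assumes "geodesic_line V E L" "\<epsilon> \<in> {1, -1}"
  shows "geodesic_ray V E (\<lambda>n. L (i + \<epsilon> * int n))"
  using assms by (auto simp: geodesic_line_def geodesic_ray_def)

lemma line_ray_cofinal:
  fixes \<epsilon> :: int
  assumes "\<epsilon> \<in> {1, -1}"
  shows "cofinal_rays (\<lambda>n. L (i + \<epsilon> * int n)) (\<lambda>n. L (\<epsilon> * int n))"
proof -
  \<comment> \<open>At most one of the two offsets is nonzero: the displacement \<open>i\<close> is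
    absorbed by whichever ray has to start later.\<close>
  have "i + \<epsilon> * int (nat (- \<epsilon> * i) + k) = \<epsilon> * int (nat (\<epsilon> * i) + k)" for k
    using assms by (auto simp: algebra_simps)
  then show ?thesis unfolding cofinal_rays_def by metis
qed

section \<open>Relatively compact sets in topological groups\<close>

lemma continuous_map_l_translation:
  assumes "locally_compact_group H X" "g \<in> carrier H"
  shows "continuous_map X X (\<lambda>h. g \<otimes>\<^bsub>H\<^esub> h)"
proof -
  have "continuous_map X (prod_topology X X) (\<lambda>h. (g, h))"
    using assms by (simp add: locally_compact_group_def continuous_map_pairedI)
  moreover have "continuous_map (prod_topology X X) X (\<lambda>(g, h). g \<otimes>\<^bsub>H\<^esub> h)"
    using assms(1) by (simp add: locally_compact_group_def)
  ultimately have "continuous_map X X ((\<lambda>(g, h). g \<otimes>\<^bsub>H\<^esub> h) \<circ> (\<lambda>h. (g, h)))"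
    by (rule continuous_map_compose)
  then show ?thesis by (simp add: comp_def)
qed

text \<open>The coset is the preimage of \<open>W\<close> under translation by the inverse of
  \<open>g\<close>.\<close>

lemma openin_l_coset:
  assumes H: "locally_compact_group H X" and g: "g \<in> carrier H" and W: "openin X W"
  shows "openin X (g <#\<^bsub>H\<^esub> W)"
proof -
  interpret group H using H by (simp add: locally_compact_group_def)
  have top: "topspace X = carrier H" using H by (simp add: locally_compact_group_def)
  have "W \<subseteq> carrier H" using openin_subset[OF W] top by simp
  then have "g <#\<^bsub>H\<^esub> W = {h \<in> topspace X. inv\<^bsub>H\<^esub> g \<otimes>\<^bsub>H\<^esub> h \<in> W}"
    using g inv_solve_left' by (force simp: l_coset_def top m_assoc[symmetric])
  moreover have "openin X {h \<in> topspace X. inv\<^bsub>H\<^esub> g \<otimes>\<^bsub>H\<^esub> h \<in> W}"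
    using continuous_map_l_translation[OF H inv_closed[OF g]] W
    by (rule openin_continuous_map_preimage)
  ultimately show ?thesis by simp
qed

lemma compactin_l_coset:
  assumes "locally_compact_group H X" "g \<in> carrier H" "compactin X C"
  shows "compactin X (g <#\<^bsub>H\<^esub> C)"
proof -
  have "g <#\<^bsub>H\<^esub> C = (\<lambda>h. g \<otimes>\<^bsub>H\<^esub> h) ` C" by (auto simp: l_coset_def)
  then show ?thesis
    using image_compactin[OF assms(3) continuous_map_l_translation[OF assms(1,2)]] by simp
qed

text \<open>If the closure is compact, the translates of the interior of \<open>C\<close> by its
  points cover it, and finitely many suffice. Conversely, a finite union of translates of
  \<open>C\<close> is compact, hence closed in a Hausdorff space, and so contains the closure of
  \<open>S\<close>.\<close>

lemma relatively_compact_iff_cosets: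
  assumes H: "locally_compact_group H X"
    and C: "compactin X C" "\<one>\<^bsub>H\<^esub> \<in> X interior_of C"
    and S: "S \<subseteq> carrier H"
  shows "relatively_compact X S \<longleftrightarrow>
    (\<exists>F. finite F \<and> F \<subseteq> carrier H \<and> S \<subseteq> (\<Union>g\<in>F. g <#\<^bsub>H\<^esub> C))"
proof
  interpret group H using H by (simp add: locally_compact_group_def)
  have top: "topspace X = carrier H" and haus: "Hausdorff_space X"
    using H by (simp_all add: locally_compact_group_def)
  {
    assume "relatively_compact X S"
    then have D: "compactin X (X closure_of S)" by (simp add: relatively_compact_def)
    let ?I = "X interior_of C"
    have "X closure_of S \<subseteq> carrier H" using closure_of_subset_topspace top by metis
    moreover have "g \<in> g <#\<^bsub>H\<^esub> ?I" if "g \<in> carrier H" for g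
      using C(2) that by (force simp: l_coset_def)
    ultimately have "X closure_of S \<subseteq> \<Union>((\<lambda>g. g <#\<^bsub>H\<^esub> ?I) ` (X closure_of S))"
      by blast
    moreover have "\<forall>U \<in> (\<lambda>g. g <#\<^bsub>H\<^esub> ?I) ` (X closure_of S). openin X U"
      using openin_l_coset[OF H _ openin_interior_of] \<open>X closure_of S \<subseteq> carrier H\<close> by blast
    ultimately obtain \<F> where \<F>: "finite \<F>" "\<F> \<subseteq> (\<lambda>g. g <#\<^bsub>H\<^esub> ?I) ` (X closure_of S)"
      "X closure_of S \<subseteq> \<Union>\<F>"
      using D unfolding compactin_def by meson
    from finite_subset_image[OF \<F>(1,2)] obtain F where
      F: "F \<subseteq> X closure_of S" "finite F" "\<F> = (\<lambda>g. g <#\<^bsub>H\<^esub> ?I) ` F" by blast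
    have "S \<subseteq> (\<Union>g\<in>F. g <#\<^bsub>H\<^esub> ?I)"
      using closure_of_subset[of S X] S top \<F>(3) F(3) by auto
    also have "\<dots> \<subseteq> (\<Union>g\<in>F. g <#\<^bsub>H\<^esub> C)"
      using interior_of_subset[of X C] by (auto simp: l_coset_def)
    finally show "\<exists>F. finite F \<and> F \<subseteq> carrier H \<and> S \<subseteq> (\<Union>g\<in>F. g <#\<^bsub>H\<^esub> C)"
      using F(1,2) \<open>X closure_of S \<subseteq> carrier H\<close> by blast
  next
    assume "\<exists>F. finite F \<and> F \<subseteq> carrier H \<and> S \<subseteq> (\<Union>g\<in>F. g <#\<^bsub>H\<^esub> C)"
    then obtain F where F: "finite F" "F \<subseteq> carrier H" "S \<subseteq> (\<Union>g\<in>F. g <#\<^bsub>H\<^esub> C)" by blast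
    have comp: "compactin X (\<Union>g\<in>F. g <#\<^bsub>H\<^esub> C)"
      using F(1,2) compactin_l_coset[OF H _ C(1)] by (intro compactin_Union) auto
    with haus have "closedin X (\<Union>g\<in>F. g <#\<^bsub>H\<^esub> C)" by (rule compactin_imp_closedin)
    with F(3) have "X closure_of S \<subseteq> (\<Union>g\<in>F. g <#\<^bsub>H\<^esub> C)" by (rule closure_of_minimal)
    with comp show "relatively_compact X S"
      unfolding relatively_compact_def by (rule closed_compactin) simp
  }
qed

section \<open>Contraction groups and bounded conjugates\<close>

lemma limitin_one_iff:
  assumes "neighbourhood_basis X e \<B>" "e \<in> topspace X"
  shows "limitin X f e F \<longleftrightarrow> (\<forall>B\<in>\<B>. \<forall>\<^sub>F n in F. f n \<in> B)"
proof
  assume lim: "limitin X f e F"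
  show "\<forall>B\<in>\<B>. \<forall>\<^sub>F n in F. f n \<in> B"
  proof
    fix B assume "B \<in> \<B>"
    then have "e \<in> X interior_of B" using assms(1) by (simp add: neighbourhood_basis_def)
    with lim have "\<forall>\<^sub>F n in F. f n \<in> X interior_of B" by (simp add: limitin_def)
    then show "\<forall>\<^sub>F n in F. f n \<in> B"
      by (rule eventually_mono) (use interior_of_subset[of X B] in blast)
  qed
next
  assume ev: "\<forall>B\<in>\<B>. \<forall>\<^sub>F n in F. f n \<in> B"
  show "limitin X f e F"
    unfolding limitin_def
  proof (intro conjI allI impI)
    fix W assume "openin X W \<and> e \<in> W"
    then obtain B where "B \<in> \<B>" "B \<subseteq> W"
      using assms(1) unfolding neighbourhood_basis_def by meson
    with ev have "\<forall>\<^sub>F n in F. f n \<in> B" by blast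
    then show "\<forall>\<^sub>F n in F. f n \<in> W"
      by (rule eventually_mono) (use \<open>B \<subseteq> W\<close> in blast)
  qed (rule assms(2))
qed

lemma (in group) conj_mult:
  assumes "c \<in> carrier G" "h \<in> carrier G" "k \<in> carrier G"
  shows "inv c \<otimes> (h \<otimes> k) \<otimes> c = (inv c \<otimes> h \<otimes> c) \<otimes> (inv c \<otimes> k \<otimes> c)"
proof -
  have "c \<otimes> (inv c \<otimes> (k \<otimes> c)) = k \<otimes> c"
    using assms by (simp add: m_assoc[symmetric])
  then show ?thesis using assms by (simp add: m_assoc)
qed

lemma (in group) conj_inv:
  assumes "c \<in> carrier G" "h \<in> carrier G"
  shows "inv c \<otimes> inv h \<otimes> c = inv (inv c \<otimes> h \<otimes> c)"
  using assms by (simp add: m_assoc inv_mult_group)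

text \<open>Conjugation is a homomorphism. With a neighbourhood basis of subgroups, convergence to
  the identity means being eventually in each of them, a condition inherited by products and
  inverses.\<close>

lemma U_plus_subgroup:
  fixes G :: "'g monoid" (structure)
  assumes "group G"
    and basis: "neighbourhood_basis X \<one> \<B>" and top: "topspace X = carrier G"
    and sub: "\<And>B. B \<in> \<B> \<Longrightarrow> subgroup B G"
    and \<gamma>: "\<And>n. \<gamma> n \<in> carrier G"
  shows "subgroup (U_plus G X \<gamma>) G"
proof -
  interpret group G by fact
  have U: "U_plus G X \<gamma> =
      {h \<in> carrier G. \<forall>B\<in>\<B>. \<forall>\<^sub>F n in sequentially. inv (\<gamma> n) \<otimes> h \<otimes> \<gamma> n \<in> B}"
    unfolding U_plus_def using top by (simp add: limitin_one_iff[OF basis])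
  show ?thesis
  proof (rule subgroupI)
    have "\<one> \<in> U_plus G X \<gamma>"
      using \<gamma> sub by (auto simp: U subgroup.one_closed)
    then show "U_plus G X \<gamma> \<noteq> {}" by blast
  next
    fix h assume h: "h \<in> U_plus G X \<gamma>"
    then have hG: "h \<in> carrier G" by (simp add: U)
    have "\<forall>\<^sub>F n in sequentially. inv (\<gamma> n) \<otimes> inv h \<otimes> \<gamma> n \<in> B" if "B \<in> \<B>" for B
    proof -
      have "\<forall>\<^sub>F n in sequentially. inv (\<gamma> n) \<otimes> h \<otimes> \<gamma> n \<in> B" using h that by (simp add: U)
      then show ?thesis
        by (rule eventually_mono) (simp add: conj_inv \<gamma> hG subgroup.m_inv_closed[OF sub[OF that]])
    qed
    then show "inv h \<in> U_plus G X \<gamma>" using hG by (simp add: U)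
  next
    fix h k assume h: "h \<in> U_plus G X \<gamma>" and k: "k \<in> U_plus G X \<gamma>"
    then have hk: "h \<in> carrier G" "k \<in> carrier G" by (simp_all add: U)
    have "\<forall>\<^sub>F n in sequentially. inv (\<gamma> n) \<otimes> (h \<otimes> k) \<otimes> \<gamma> n \<in> B" if "B \<in> \<B>" for B
    proof -
      have "\<forall>\<^sub>F n in sequentially. inv (\<gamma> n) \<otimes> h \<otimes> \<gamma> n \<in> B"
        "\<forall>\<^sub>F n in sequentially. inv (\<gamma> n) \<otimes> k \<otimes> \<gamma> n \<in> B"
        using h k that by (simp_all add: U)
      then show ?thesis
        by eventually_elim (simp add: conj_mult \<gamma> hk subgroup.m_closed[OF sub[OF that]])
    qed
    then show "h \<otimes> k \<in> U_plus G X \<gamma>" using hk by (simp add: U)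
  qed (auto simp: U)
qed

text \<open>The conjugates eventually lie in \<open>C\<close> itself, and each of the finitely many
  earlier ones is covered by its own coset.\<close>

lemma U_plus_subset_P_plus:
  assumes H: "locally_compact_group H X"
    and C: "compactin X C" "\<one>\<^bsub>H\<^esub> \<in> X interior_of C"
    and \<gamma>: "\<And>n. \<gamma> n \<in> carrier H"
  shows "U_plus H X \<gamma> \<subseteq> P_plus H X \<gamma>"
proof
  interpret group H using H by (simp add: locally_compact_group_def)
  fix h assume "h \<in> U_plus H X \<gamma>"
  then have h: "h \<in> carrier H"
    and lim: "limitin X (\<lambda>n. inv\<^bsub>H\<^esub> (\<gamma> n) \<otimes>\<^bsub>H\<^esub> h \<otimes>\<^bsub>H\<^esub> \<gamma> n) \<one>\<^bsub>H\<^esub> sequentially"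
    by (simp_all add: U_plus_def)
  define c where "c n = inv\<^bsub>H\<^esub> (\<gamma> n) \<otimes>\<^bsub>H\<^esub> h \<otimes>\<^bsub>H\<^esub> \<gamma> n" for n
  have c: "c n \<in> carrier H" for n using h \<gamma> by (simp add: c_def)
  have "\<forall>\<^sub>F n in sequentially. c n \<in> X interior_of C"
    using lim C(2) by (simp add: limitin_def c_def)
  then obtain N where N: "\<And>n. n \<ge> N \<Longrightarrow> c n \<in> C"
    using interior_of_subset[of X C] unfolding eventually_sequentially by blast
  have C_sub: "C \<subseteq> carrier H" and one: "\<one>\<^bsub>H\<^esub> \<in> C"
    using compactin_subset_topspace[OF C(1)] H C(2) interior_of_subset[of X C]
    by (auto simp: locally_compact_group_def)
  have "c n \<in> (\<Union>g \<in> insert \<one>\<^bsub>H\<^esub> (c ` {..<N}). g <#\<^bsub>H\<^esub> C)" for n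
  proof (cases "n < N")
    case True
    have "c n = c n \<otimes>\<^bsub>H\<^esub> \<one>\<^bsub>H\<^esub>" using c by simp
    then have "c n \<in> c n <#\<^bsub>H\<^esub> C" using one by (auto simp: l_coset_def)
    with True show ?thesis by blast
  next
    case False
    then have "c n \<in> C" using N by simp
    moreover have "c n = \<one>\<^bsub>H\<^esub> \<otimes>\<^bsub>H\<^esub> c n" using c by simp
    ultimately have "c n \<in> \<one>\<^bsub>H\<^esub> <#\<^bsub>H\<^esub> C" by (auto simp: l_coset_def)
    then show ?thesis by blast
  qed
  then have "{c n |n. n > 0} \<subseteq> (\<Union>g \<in> insert \<one>\<^bsub>H\<^esub> (c ` {..<N}). g <#\<^bsub>H\<^esub> C)" by blast
  moreover have "finite (insert \<one>\<^bsub>H\<^esub> (c ` {..<N}))" "insert \<one>\<^bsub>H\<^esub> (c ` {..<N}) \<subseteq> carrier H"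
    using c by auto
  moreover have "{c n |n. n > 0} \<subseteq> carrier H" using c by blast
  ultimately have "relatively_compact X {c n |n. n > 0}"
    using relatively_compact_iff_cosets[OF H C] by blast
  then show "h \<in> P_plus H X \<gamma>" using h by (simp add: P_plus_def c_def)
qed

text \<open>Membership is asked for positive indices only, because the lift \<open>\<beta>t\<close>
  of the theorem may leave the extension at index 0.\<close>

lemma P_minus_eq_P_plus:
  fixes G :: "'g monoid" (structure)
  assumes "group G" "\<And>n. n > 0 \<Longrightarrow> \<gamma> n \<in> carrier G"
  shows "P_minus G X \<gamma> = P_plus G X (\<lambda>n. inv (\<gamma> n))"
proof -
  interpret group G by fact
  have "{\<gamma> n \<otimes> h \<otimes> inv (\<gamma> n) |n. n > 0} = {inv (inv (\<gamma> n)) \<otimes> h \<otimes> inv (\<gamma> n) |n. n > 0}" for h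
    using assms(2) inv_inv by metis
  then show ?thesis by (simp add: P_minus_def P_plus_def)
qed

lemma U_minus_eq_U_plus:
  fixes G :: "'g monoid" (structure)
  assumes "group G" "\<And>n. \<gamma> n \<in> carrier G"
  shows "U_minus G X \<gamma> = U_plus G X (\<lambda>n. inv (\<gamma> n))"
  using assms by (simp add: U_minus_def U_plus_def group.inv_inv)

section \<open>Stabilizers of ends\<close>

text \<open>The end action is an image of a set of rays. That every ray cofinal with the image of
  \<open>r\<close> is itself such an image is seen by pulling it back along the inverse
  automorphism.\<close>

lemma end_action_end_of:
  assumes f: "graph_automorphism V E (\<phi> g)" and r: "geodesic_ray V E r"
  shows "end_action \<phi> g (end_of V E r) = end_of V E (\<phi> g \<circ> r)"
proof
  show "end_action \<phi> g (end_of V E r) \<subseteq> end_of V E (\<phi> g \<circ> r)"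
    using graph_automorphism_ray[OF f] cofinal_map[of r _ "\<phi> g"]
    by (auto simp: end_action_def end_of_def)
  show "end_of V E (\<phi> g \<circ> r) \<subseteq> end_action \<phi> g (end_of V E r)"
  proof
    fix s assume "s \<in> end_of V E (\<phi> g \<circ> r)"
    then have s: "geodesic_ray V E s" "cofinal_rays (\<phi> g \<circ> r) s" by (auto simp: end_of_def)
    let ?h = "inv_into V (\<phi> g)"
    have "?h \<circ> (\<phi> g \<circ> r) = r"
      using f geodesic_ray_mem[OF r] by (auto simp: graph_automorphism_def bij_betw_def)
    then have "cofinal_rays r (?h \<circ> s)" using cofinal_map[OF s(2), of ?h] by simp
    moreover have "geodesic_ray V E (?h \<circ> s)"
      using graph_automorphism_ray[OF graph_automorphism_inv[OF f] s(1)] .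
    ultimately have "?h \<circ> s \<in> end_of V E r" by (simp add: end_of_def)
    moreover have "s = \<phi> g \<circ> (?h \<circ> s)"
      using f geodesic_ray_mem[OF s(1)]
      by (auto simp: graph_automorphism_def bij_betw_def f_inv_into_f)
    ultimately show "s \<in> end_action \<phi> g (end_of V E r)"
      unfolding end_action_def by blast
  qed
qed

lemma end_action_fixes_iff:
  assumes "graph_automorphism V E (\<phi> g)" "geodesic_ray V E r"
  shows "end_action \<phi> g (end_of V E r) = end_of V E r \<longleftrightarrow> cofinal_rays (\<phi> g \<circ> r) r"
  using end_action_end_of[where \<phi> = \<phi> and g = g, OF assms] end_of_eq_iff[OF graph_automorphism_ray[OF assms] assms(2)]
  by simp

lemma action_graph_automorphism:
  assumes "acts_by_automorphisms G V E \<phi>" "g \<in> carrier G"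
  shows "graph_automorphism V E (\<phi> g)"
proof -
  interpret group_action G V \<phi> using assms(1) by (simp add: acts_by_automorphisms_def)
  have "bij_betw (\<phi> g) V V" using bij_prop0[OF assms(2)] by (simp add: Bij_def)
  then show ?thesis using assms by (simp add: graph_automorphism_def acts_by_automorphisms_def)
qed

lemma (in group_action) one_act: "x \<in> E \<Longrightarrow> \<phi> \<one>\<^bsub>G\<^esub> x = x"
  by (simp add: id_eq_one[symmetric])

text \<open>Fixing the end is rewritten as cofinality of \<open>\<phi> g \<circ> r\<close> with
  \<open>r\<close>; the action laws on vertices and the equivalence properties of cofinality then
  give closure.\<close>

lemma end_stabilizer_subgroup:
  fixes G :: "'g monoid" (structure)
  assumes act: "acts_by_automorphisms G V E \<phi>" and r: "geodesic_ray V E r"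
  shows "subgroup (stabilizer G (end_action \<phi>) (end_of V E r)) G"
proof -
  interpret group_action G V \<phi> using act by (simp add: acts_by_automorphisms_def)
  interpret group G by (rule group_hom.axioms(1)[OF group_hom])
  note r_mem = geodesic_ray_mem[OF r]
  have stab: "stabilizer G (end_action \<phi>) (end_of V E r) =
      {g \<in> carrier G. cofinal_rays (\<phi> g \<circ> r) r}"
    using end_action_fixes_iff[where \<phi> = \<phi>, OF action_graph_automorphism[OF act] r]
    by (auto simp: stabilizer_def)
  have comp: "\<phi> (g \<otimes> h) \<circ> r = \<phi> g \<circ> (\<phi> h \<circ> r)"
    if "g \<in> carrier G" "h \<in> carrier G" for g h
    using composition_rule[OF r_mem that] by auto
  have one: "\<phi> \<one> \<circ> r = r" using one_act[OF r_mem] by auto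
  show ?thesis
    unfolding stab
  proof (rule subgroupI)
    have "\<one> \<in> {g \<in> carrier G. cofinal_rays (\<phi> g \<circ> r) r}" by (simp add: one cofinal_refl)
    then show "{g \<in> carrier G. cofinal_rays (\<phi> g \<circ> r) r} \<noteq> {}" by blast
  next
    fix g assume "g \<in> {g \<in> carrier G. cofinal_rays (\<phi> g \<circ> r) r}"
    then have g: "g \<in> carrier G" "cofinal_rays (\<phi> g \<circ> r) r" by simp_all
    have "cofinal_rays (\<phi> (inv g) \<circ> (\<phi> g \<circ> r)) (\<phi> (inv g) \<circ> r)"
      by (rule cofinal_map[OF g(2)])
    then have "cofinal_rays r (\<phi> (inv g) \<circ> r)"
      using comp[of "inv g" g] g(1) by (simp add: one)
    then show "inv g \<in> {g \<in> carrier G. cofinal_rays (\<phi> g \<circ> r) r}"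
      using g(1) cofinal_sym by simp
  next
    fix g h assume "g \<in> {g \<in> carrier G. cofinal_rays (\<phi> g \<circ> r) r}"
      "h \<in> {g \<in> carrier G. cofinal_rays (\<phi> g \<circ> r) r}"
    then have gh: "g \<in> carrier G" "h \<in> carrier G" "cofinal_rays (\<phi> g \<circ> r) r"
      "cofinal_rays (\<phi> h \<circ> r) r" by simp_all
    have "cofinal_rays (\<phi> (g \<otimes> h) \<circ> r) (\<phi> g \<circ> r)"
      unfolding comp[OF gh(1,2)] by (rule cofinal_map[OF gh(4)])
    then have "cofinal_rays (\<phi> (g \<otimes> h) \<circ> r) r" using gh(3) by (rule cofinal_trans)
    then show "g \<otimes> h \<in> {g \<in> carrier G. cofinal_rays (\<phi> g \<circ> r) r}" using gh by simp
  qed auto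
qed

section \<open>Bounded conjugates and the movement of a ray\<close>

text \<open>The orbit-stabilizer correspondence, used to turn a finite cover by cosets of
  \<open>K\<close> into a finite set of vertices and back.\<close>

lemma (in group_action) stabilizer_coset_iff:
  assumes "x \<in> E" "f \<in> carrier G" "g \<in> carrier G"
  shows "g \<in> f <#\<^bsub>G\<^esub> stabilizer G \<phi> x \<longleftrightarrow> \<phi> g x = \<phi> f x"
proof -
  interpret group G by (rule group_hom.axioms(1)[OF group_hom])
  have eq: "g = f \<otimes> (inv f \<otimes> g)" using assms by (simp add: m_assoc[symmetric])
  show ?thesis
  proof
    assume "g \<in> f <#\<^bsub>G\<^esub> stabilizer G \<phi> x"
    then obtain k where "k \<in> carrier G" "\<phi> k x = x" "g = f \<otimes> k"
      by (auto simp: l_coset_def stabilizer_def)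
    then show "\<phi> g x = \<phi> f x" using composition_rule[OF assms(1,2)] by simp
  next
    assume "\<phi> g x = \<phi> f x"
    then have "\<phi> (inv f \<otimes> g) x = \<phi> (inv f) (\<phi> f x)"
      using composition_rule[OF assms(1), of "inv f" g] assms by simp
    also have "\<dots> = \<phi> (inv f \<otimes> f) x"
      using composition_rule[OF assms(1), of "inv f" f] assms by simp
    also have "\<dots> = x" using assms one_act by simp
    finally have "inv f \<otimes> g \<in> stabilizer G \<phi> x" using assms by (simp add: stabilizer_def)
    with eq show "g \<in> f <#\<^bsub>G\<^esub> stabilizer G \<phi> x" unfolding l_coset_def by blast
  qed
qed

lemma P_plus_eq_end_stabilizer:
  fixes G :: "'g monoid" (structure)
  assumes G: "locally_compact_group G X" and tree: "tree V E"
    and act: "acts_by_automorphisms G V E \<phi>"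
    and K: "x \<in> V" "compactin X (stabilizer G \<phi> x)" "openin X (stabilizer G \<phi> x)"
    and a: "a \<in> carrier G" and r: "geodesic_ray V E (\<lambda>n. \<phi> (a [^] (n::nat)) x)"
  shows "P_plus G X (\<lambda>n. a [^] n) =
    stabilizer G (end_action \<phi>) (end_of V E (\<lambda>n. \<phi> (a [^] n) x))"
proof -
  interpret group_action G V \<phi> using act by (simp add: acts_by_automorphisms_def)
  interpret group G by (rule group_hom.axioms(1)[OF group_hom])
  define r where "r = (\<lambda>n::nat. \<phi> (a [^] n) x)"
  have ray: "geodesic_ray V E r" using r by (simp add: r_def)
  have aut: "graph_automorphism V E (\<phi> g)" if "g \<in> carrier G" for g
    using action_graph_automorphism[OF act that] .
  have "\<one> \<in> stabilizer G \<phi> x" using K(1) by (rule stabilizer_one_closed)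
  then have one: "\<one> \<in> X interior_of (stabilizer G \<phi> x)"
    using K(3) by (simp add: interior_of_openin)
  have "h \<in> P_plus G X (\<lambda>n. a [^] n) \<longleftrightarrow> cofinal_rays (\<phi> h \<circ> r) r" if h: "h \<in> carrier G" for h
  proof -
    define c where "c n = inv (a [^] n) \<otimes> h \<otimes> a [^] n" for n :: nat
    have c: "c n \<in> carrier G" for n using a h by (simp add: c_def)
    have c_act: "\<phi> (c n) x = \<phi> (inv (a [^] n)) (\<phi> h (r n))" for n
      using a h K(1) composition_rule[OF K(1), of "inv (a [^] n) \<otimes> h" "a [^] n"]
        composition_rule[OF element_image[OF _ K(1) refl], of "a [^] n" "inv (a [^] n)" h]
      by (simp add: c_def r_def)
    \<comment> \<open>Since \<open>a [^] n\<close> is an isometry, the distance from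
      \<open>r n\<close> to its image under \<open>h\<close> equals the distance from
      \<open>x\<close> to \<open>\<phi> (c n) x\<close>.\<close>
    have act_c: "\<phi> (a [^] n) (\<phi> (c n) x) = \<phi> h (r n)" for n
    proof -
      have "a [^] n \<otimes> c n = h \<otimes> a [^] n"
        using a h by (simp add: c_def m_assoc[symmetric])
      then show ?thesis
        using composition_rule[OF K(1) nat_pow_closed[OF a] c]
          composition_rule[OF K(1) h nat_pow_closed[OF a]]
        unfolding r_def by metis
    qed
    have "h \<in> P_plus G X (\<lambda>n. a [^] n) \<longleftrightarrow> relatively_compact X {c n |n. n > 0}"
      using h by (simp add: P_plus_def c_def)
    also have "\<dots> \<longleftrightarrow> (\<exists>F. finite F \<and> F \<subseteq> carrier G \<and>
        {c n |n. n > 0} \<subseteq> (\<Union>g\<in>F. g <#\<^bsub>G\<^esub> stabilizer G \<phi> x))"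
      by (rule relatively_compact_iff_cosets[OF G K(2) one]) (use c in blast)
    also have "\<dots> \<longleftrightarrow> cofinal_rays (\<phi> h \<circ> r) r"
    proof
      assume "\<exists>F. finite F \<and> F \<subseteq> carrier G \<and>
        {c n |n. n > 0} \<subseteq> (\<Union>g\<in>F. g <#\<^bsub>G\<^esub> stabilizer G \<phi> x)"
      then obtain F where F: "finite F" "F \<subseteq> carrier G"
        "{c n |n. n > 0} \<subseteq> (\<Union>g\<in>F. g <#\<^bsub>G\<^esub> stabilizer G \<phi> x)" by blast
      \<comment> \<open>The cover concerns positive indices, while the bound on distances is wanted
        at index 0 too; hence the extra element \<open>c 0\<close>.\<close>
      let ?D = "(\<lambda>f. graph_dist V E x (\<phi> f x)) ` insert (c 0) F"
      have "graph_dist V E (r n) ((\<phi> h \<circ> r) n) \<le> Max ?D" for n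
      proof -
        have "graph_dist V E (r n) ((\<phi> h \<circ> r) n) = graph_dist V E x (\<phi> (c n) x)"
          using graph_automorphism_dist[OF aut[OF nat_pow_closed[OF a]] K(1), of "\<phi> (c n) x" n]
            element_image[OF c K(1) refl] act_c by (simp add: r_def)
        moreover have "\<phi> (c n) x \<in> (\<lambda>f. \<phi> f x) ` insert (c 0) F"
        proof (cases "n = 0")
          case False
          then obtain f where "f \<in> F" "c n \<in> f <#\<^bsub>G\<^esub> stabilizer G \<phi> x" using F(3) by blast
          then show ?thesis using stabilizer_coset_iff[OF K(1) _ c] F(2) by blast
        qed simp
        ultimately have "graph_dist V E (r n) ((\<phi> h \<circ> r) n) \<in> ?D" by auto
        then show ?thesis using F(1) by (intro Max_ge) auto
      qed
      then have "cofinal_rays r (\<phi> h \<circ> r)"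
        by (rule bounded_distance_cofinal[OF tree ray graph_automorphism_ray[OF aut[OF h] ray]])
      then show "cofinal_rays (\<phi> h \<circ> r) r" by (rule cofinal_sym)
    next
      assume "cofinal_rays (\<phi> h \<circ> r) r"
      then obtain m n where mn: "\<And>k. \<phi> h (r (m + k)) = r (n + k)"
        by (auto simp: cofinal_rays_def)
      \<comment> \<open>This is the power of \<open>a\<close> with exponent \<open>n - m\<close>,
        possibly negative. From index \<open>m\<close> on, every conjugate sends \<open>x\<close>
        where \<open>f\<close> does and so lies in one coset; the first \<open>m\<close> conjugates
        contribute one coset each.\<close>
      define f where "f = inv (a [^] m) \<otimes> a [^] n"
      have f: "f \<in> carrier G" using a by (simp add: f_def)
      have "\<phi> (c (m + k)) x = \<phi> f x" for k
      proof -
        have "\<phi> (c (m + k)) x = \<phi> (inv (a [^] (m + k)) \<otimes> a [^] (n + k)) x"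
          using composition_rule[OF K(1), of "inv (a [^] (m + k))" "a [^] (n + k)"] a
          by (simp add: c_act mn) (simp add: r_def)
        also have "inv (a [^] (m + k)) \<otimes> a [^] (n + k) = inv (a [^] m) \<otimes> a [^] n"
        proof -
          have "a [^] (m + k) = a [^] k \<otimes> a [^] m" "a [^] (n + k) = a [^] k \<otimes> a [^] n"
            using a by (simp_all add: nat_pow_mult add.commute)
          moreover have "inv (a [^] k) \<otimes> (a [^] k \<otimes> a [^] n) = a [^] n"
            using a by (simp add: m_assoc[symmetric])
          ultimately show ?thesis using a by (simp add: inv_mult_group m_assoc)
        qed
        finally show ?thesis by (simp add: f_def)
      qed
      then have "\<phi> (c j) x \<in> (\<lambda>g. \<phi> g x) ` insert f (c ` {..<m})" for j
        by (cases "j < m") (auto simp: not_less dest: le_Suc_ex)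
      then have "\<exists>g \<in> insert f (c ` {..<m}). c j \<in> g <#\<^bsub>G\<^esub> stabilizer G \<phi> x" for j
        using stabilizer_coset_iff[OF K(1) _ c] c f by (smt (verit) image_iff insert_iff)
      then have "{c n |n. n > 0} \<subseteq> (\<Union>g\<in>insert f (c ` {..<m}). g <#\<^bsub>G\<^esub> stabilizer G \<phi> x)"
        by blast
      moreover have "finite (insert f (c ` {..<m}))" "insert f (c ` {..<m}) \<subseteq> carrier G"
        using c f by auto
      ultimately show "\<exists>F. finite F \<and> F \<subseteq> carrier G \<and>
          {c n |n. n > 0} \<subseteq> (\<Union>g\<in>F. g <#\<^bsub>G\<^esub> stabilizer G \<phi> x)"
        by blast
    qed
    finally show ?thesis .
  qed
  moreover have "P_plus G X (\<lambda>n. a [^] n) \<subseteq> carrier G" by (auto simp: P_plus_def)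
  ultimately show ?thesis
    using end_action_fixes_iff[where \<phi> = \<phi>, OF aut ray] unfolding stabilizer_def r_def by blast
qed

text \<open>
  If the attracting end were the other endpoint, the orbit of \<open>L 0\<close> would reach its ray without
  passing through \<open>L 0\<close>.
\<close>
lemma attracting_end_eq:
  assumes tree: "tree V E" and act: "acts_by_automorphisms G V E \<phi>" and a: "a \<in> carrier G"
    and L: "geodesic_line V E L" and x: "x = L i"
    and translates: "translates_line \<phi> a L 1"
    and \<xi>: "\<xi> \<in> line_endpoints V E L" "attracting_end G V E \<phi> a \<xi>"
  shows "geodesic_ray V E (\<lambda>n. \<phi> (a [^]\<^bsub>G\<^esub> (n::nat)) x)"
    and "\<xi> = end_of V E (\<lambda>n. \<phi> (a [^]\<^bsub>G\<^esub> (n::nat)) x)"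
proof -
  interpret group_action G V \<phi> using act by (simp add: acts_by_automorphisms_def)
  interpret group G by (rule group_hom.axioms(1)[OF group_hom])
  obtain \<epsilon> :: int where \<epsilon>: "\<epsilon> \<in> {1, -1}" and aL: "\<And>i. \<phi> a (L i) = L (i + \<epsilon>)"
    using translates unfolding translates_line_def by fastforce
  have L_mem: "L i \<in> V" for i using L by (auto simp: geodesic_line_def)
  have pow: "\<phi> (a [^]\<^bsub>G\<^esub> n) (L i) = L (i + \<epsilon> * int n)" for n i
  proof (induction n arbitrary: i)
    case 0
    show ?case using one_act[OF L_mem] by simp
  next
    case (Suc n)
    have "\<phi> (a [^]\<^bsub>G\<^esub> Suc n) (L i) = \<phi> (a [^]\<^bsub>G\<^esub> n) (\<phi> a (L i))"
      using composition_rule[OF L_mem, of "a [^]\<^bsub>G\<^esub> n" a] a by simp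
    then show ?case by (simp add: aL Suc.IH algebra_simps)
  qed
  have r_eq: "(\<lambda>n. \<phi> (a [^]\<^bsub>G\<^esub> (n::nat)) x) = (\<lambda>n. L (i + \<epsilon> * int n))"
    by (simp add: pow x)
  show ray: "geodesic_ray V E (\<lambda>n. \<phi> (a [^]\<^bsub>G\<^esub> (n::nat)) x)"
    unfolding r_eq by (rule geodesic_line_ray[OF L \<epsilon>])
  \<comment> \<open>The line endpoints are parametrized from \<open>L 0\<close> and the orbit starts
    at \<open>L i\<close>; the two rays share a tail.\<close>
  have eq: "end_of V E (\<lambda>n. \<phi> (a [^]\<^bsub>G\<^esub> (n::nat)) x) = end_of V E (\<lambda>n. L (\<epsilon> * int n))"
    unfolding r_eq
    using end_of_eq_iff[OF geodesic_line_ray[OF L \<epsilon>, of i] geodesic_line_ray[OF L \<epsilon>, of 0]]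
      line_ray_cofinal[OF \<epsilon>] by simp
  have "\<xi> \<noteq> end_of V E (\<lambda>n. L (- \<epsilon> * int n))"
  proof
    assume \<xi>': "\<xi> = end_of V E (\<lambda>n. L (- \<epsilon> * int n))"
    have \<epsilon>': "- \<epsilon> \<in> {1, -1}" using \<epsilon> by auto
    have "(\<lambda>n. L (- \<epsilon> * int n)) \<in> \<xi>"
      using geodesic_line_ray[OF L \<epsilon>', of 0] cofinal_refl by (simp add: \<xi>' end_of_def)
    \<comment> \<open>Convergence is tested with the single vertex \<open>L 0\<close> removed and
      for the orbit of \<open>L 0\<close> itself.\<close>
    then have "\<forall>\<^sub>F n in sequentially. \<forall>\<^sub>F m in sequentially.
        \<exists>p. walk (V - {L 0}) E (\<phi> (a [^]\<^bsub>G\<^esub> n) (L 0)) p (L (- \<epsilon> * int m))"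
      using \<xi>(2) L_mem[of 0] unfolding attracting_end_def converges_to_end_def
      by (meson finite.emptyI finite_insert)
    \<comment> \<open>Positive \<open>n\<close>, and below positive \<open>m\<close>, place the two
      ends of the walk strictly on opposite sides of \<open>L 0\<close>.\<close>
    from eventually_happens'[OF sequentially_bot eventually_conj[OF eventually_gt_at_top[of 0] this]]
    obtain n :: nat where n: "n > 0" "\<forall>\<^sub>F m in sequentially.
        \<exists>p. walk (V - {L 0}) E (\<phi> (a [^]\<^bsub>G\<^esub> n) (L 0)) p (L (- \<epsilon> * int m))" by blast
    from eventually_happens'[OF sequentially_bot eventually_conj[OF eventually_gt_at_top[of 0] n(2)]]
    obtain m where "m > 0"
        "\<exists>p. walk (V - {L 0}) E (\<phi> (a [^]\<^bsub>G\<^esub> n) (L 0)) p (L (- \<epsilon> * int m))" by blast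
    then obtain p where p: "walk (V - {L 0}) E (L (\<epsilon> * int n)) p (L (- \<epsilon> * int m))"
      unfolding pow by auto
    \<comment> \<open>The line is run against the translation, so that \<open>L 0\<close> is passed
      at time \<open>n\<close>, strictly between the times 0 and \<open>n + m\<close> of the ends of
      the walk.\<close>
    define s where "s k = L (\<epsilon> * int n + - \<epsilon> * int k)" for k
    have s: "geodesic_ray V E s" unfolding s_def by (rule geodesic_line_ray[OF L \<epsilon>'])
    have s_vals: "s 0 = L (\<epsilon> * int n)" "s n = L 0" "s (n + m) = L (- \<epsilon> * int m)"
      by (simp_all add: s_def algebra_simps)
    have "walk V E (L (\<epsilon> * int n)) p (L (- \<epsilon> * int m))" "L 0 \<notin> set p"
      using p by (auto simp: walk_def)
    then have "joined_off E (L 0) (L (\<epsilon> * int n)) (L (- \<epsilon> * int m))"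
      by (rule walk_joined_off)
    then show False
      using geodesic_ray_separated[OF tree s, of 0 n "n + m"] \<open>n > 0\<close> \<open>m > 0\<close>
      unfolding s_vals by simp
  qed
  then show "\<xi> = end_of V E (\<lambda>n. \<phi> (a [^]\<^bsub>G\<^esub> (n::nat)) x)"
    using \<xi>(1) \<epsilon> unfolding eq line_endpoints_def by auto
qed

section \<open>The extension\<close>

lemma ext_simps:
  "carrier (cocycle_extension G T \<alpha>) = carrier G \<times> carrier T"
  "(g, s) \<otimes>\<^bsub>cocycle_extension G T \<alpha>\<^esub> (h, t) = (g \<otimes>\<^bsub>G\<^esub> h, \<alpha> g h \<otimes>\<^bsub>T\<^esub> s \<otimes>\<^bsub>T\<^esub> t)"
  "\<one>\<^bsub>cocycle_extension G T \<alpha>\<^esub> = (\<one>\<^bsub>G\<^esub>, \<one>\<^bsub>T\<^esub>)"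
  by (simp_all add: cocycle_extension_def)

text \<open>Through this projection the first components of inverses and conjugates in the extension
  are obtained without a formula for its inverse.\<close>

lemma ext_fst_hom:
  assumes "group G" "group (cocycle_extension G T \<alpha>)"
  shows "group_hom (cocycle_extension G T \<alpha>) G fst"
  using assms by (auto simp: group_hom_def group_hom_axioms_def hom_def ext_simps)

lemma ext_preimage_subgroup:
  assumes "group G" "group (cocycle_extension G T \<alpha>)" "subgroup H G"
  shows "subgroup (H \<times> carrier T) (cocycle_extension G T \<alpha>)"
proof -
  interpret group_hom "cocycle_extension G T \<alpha>" G fst using ext_fst_hom[OF assms(1,2)] .
  interpret sub: subgroup H G by fact
  have "H \<times> carrier T = {g \<in> carrier (cocycle_extension G T \<alpha>). fst g \<in> H}"
    using sub.subset by (auto simp: ext_simps)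
  moreover have "subgroup {g \<in> carrier (cocycle_extension G T \<alpha>). fst g \<in> H} (cocycle_extension G T \<alpha>)"
  proof (rule G.subgroupI)
    have "\<one>\<^bsub>cocycle_extension G T \<alpha>\<^esub> \<in> {g \<in> carrier (cocycle_extension G T \<alpha>). fst g \<in> H}"
      using hom_one by simp
    then show "{g \<in> carrier (cocycle_extension G T \<alpha>). fst g \<in> H} \<noteq> {}" by blast
  qed auto
  ultimately show ?thesis by simp
qed

section \<open>Relative compactness in the extension\<close>

text \<open>The topology of the extension is given only near its identity. Compactness is
  transported along the section sending \<open>k\<close> to \<open>(k, \<one>)\<close>, which is
  multiplicative on \<open>K\<close> because the cocycle is trivial there; continuity at each point
  is therefore reduced to the identity by translation.\<close>

lemma ext_compact_neighbourhood:
  fixes G :: "'g monoid"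
  assumes G: "locally_compact_group G X" and Gt: "locally_compact_group (cocycle_extension G T \<alpha>) Xt"
    and T: "group T"
    and K: "K \<in> compact_open_subgroups G X K" and \<alpha>: "\<forall>k1\<in>K. \<forall>k2\<in>K. \<alpha> k1 k2 = \<one>\<^bsub>T\<^esub>"
    and basis: "neighbourhood_basis Xt \<one>\<^bsub>cocycle_extension G T \<alpha>\<^esub>
      {U \<times> {\<one>\<^bsub>T\<^esub>} |U. U \<in> compact_open_subgroups G X K}"
  shows "compactin Xt (K \<times> {\<one>\<^bsub>T\<^esub>})"
    and "\<one>\<^bsub>cocycle_extension G T \<alpha>\<^esub> \<in> Xt interior_of (K \<times> {\<one>\<^bsub>T\<^esub>})"
proof -
  let ?H = "cocycle_extension G T \<alpha>"
  interpret G: group G using G by (simp add: locally_compact_group_def)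
  interpret T: group T by fact
  interpret H: group ?H using Gt by (simp add: locally_compact_group_def)
  have K': "subgroup K G" "compactin X K" "openin X K"
    using K by (auto simp: compact_open_subgroups_def)
  have topX: "topspace X = carrier G" and topXt: "topspace Xt = carrier ?H"
    using G Gt by (auto simp: locally_compact_group_def)
  have K_sub: "K \<subseteq> carrier G" using K'(1) by (rule subgroup.subset)
  show "\<one>\<^bsub>?H\<^esub> \<in> Xt interior_of (K \<times> {\<one>\<^bsub>T\<^esub>})"
    using basis K unfolding neighbourhood_basis_def by blast
  have "continuous_map (subtopology X K) Xt (\<lambda>k. (k, \<one>\<^bsub>T\<^esub>))"
    unfolding continuous_map_def
  proof (intro conjI allI impI)
    show "(\<lambda>k. (k, \<one>\<^bsub>T\<^esub>)) \<in> topspace (subtopology X K) \<rightarrow> topspace Xt"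
      using K_sub by (auto simp: topXt ext_simps)
    fix W assume W: "openin Xt W"
    have "openin X {k \<in> K. (k, \<one>\<^bsub>T\<^esub>) \<in> W}"
    proof (subst openin_subopen, intro ballI)
      fix k assume "k \<in> {k \<in> K. (k, \<one>\<^bsub>T\<^esub>) \<in> W}"
      then have k: "k \<in> K" "(k, \<one>\<^bsub>T\<^esub>) \<in> W" by simp_all
      have kH: "(k, \<one>\<^bsub>T\<^esub>) \<in> carrier ?H" using k(1) K_sub by (auto simp: ext_simps)
      \<comment> \<open>The preimage of \<open>W\<close> under translation by
        \<open>(k, \<one>)\<close> is a neighbourhood of the identity, where the given basis
        applies.\<close>
      let ?W = "{h \<in> topspace Xt. (k, \<one>\<^bsub>T\<^esub>) \<otimes>\<^bsub>?H\<^esub> h \<in> W}"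
      have "openin Xt ?W"
        using continuous_map_l_translation[OF Gt kH] W by (rule openin_continuous_map_preimage)
      moreover have "\<one>\<^bsub>?H\<^esub> \<in> ?W" using k kH by (simp add: topXt)
      ultimately obtain U where U: "U \<in> compact_open_subgroups G X K" "U \<times> {\<one>\<^bsub>T\<^esub>} \<subseteq> ?W"
        using basis unfolding neighbourhood_basis_def by blast
      have U': "subgroup U G" "openin X U" "U \<subseteq> K"
        using U(1) by (auto simp: compact_open_subgroups_def)
      have "k <#\<^bsub>G\<^esub> U \<subseteq> {k \<in> K. (k, \<one>\<^bsub>T\<^esub>) \<in> W}"
      proof
        fix h assume "h \<in> k <#\<^bsub>G\<^esub> U"
        then obtain u where u: "u \<in> U" "h = k \<otimes>\<^bsub>G\<^esub> u" by (auto simp: l_coset_def)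
        then have "(k, \<one>\<^bsub>T\<^esub>) \<otimes>\<^bsub>?H\<^esub> (u, \<one>\<^bsub>T\<^esub>) \<in> W" using U(2) by auto
        moreover have "\<alpha> k u = \<one>\<^bsub>T\<^esub>" using \<alpha> k(1) u(1) U'(3) by blast
        ultimately have "(h, \<one>\<^bsub>T\<^esub>) \<in> W" by (simp add: ext_simps u(2))
        moreover have "h \<in> K" using u k(1) U'(3) subgroup.m_closed[OF K'(1)] by blast
        ultimately show "h \<in> {k \<in> K. (k, \<one>\<^bsub>T\<^esub>) \<in> W}" by simp
      qed
      moreover have "openin X (k <#\<^bsub>G\<^esub> U)" using openin_l_coset[OF G _ U'(2)] k(1) K_sub by blast
      moreover have "k \<in> k <#\<^bsub>G\<^esub> U"
        using subgroup.one_closed[OF U'(1)] k(1) K_sub by (force simp: l_coset_def)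
      ultimately show "\<exists>T'. openin X T' \<and> k \<in> T' \<and> T' \<subseteq> {k \<in> K. (k, \<one>\<^bsub>T\<^esub>) \<in> W}" by blast
    qed
    moreover have "{k \<in> topspace (subtopology X K). (k, \<one>\<^bsub>T\<^esub>) \<in> W} = {k \<in> K. (k, \<one>\<^bsub>T\<^esub>) \<in> W}"
      using K_sub by (auto simp: topX)
    ultimately show "openin (subtopology X K) {k \<in> topspace (subtopology X K). (k, \<one>\<^bsub>T\<^esub>) \<in> W}"
      using K'(3) by (auto simp: openin_open_subtopology)
  qed
  then have "compactin Xt ((\<lambda>k. (k, \<one>\<^bsub>T\<^esub>)) ` K)"
    using K'(2) by (intro image_compactin[of "subtopology X K"]) (auto simp: compactin_subtopology)
  moreover have "(\<lambda>k. (k, \<one>\<^bsub>T\<^esub>)) ` K = K \<times> {\<one>\<^bsub>T\<^esub>}" by auto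
  ultimately show "compactin Xt (K \<times> {\<one>\<^bsub>T\<^esub>})" by simp
qed

text \<open>Cosets of \<open>K \<times> {\<one>}\<close> project into cosets of \<open>K\<close>. In
  the other direction each representative \<open>f\<close> is replaced by all the pairs
  \<open>(f, u)\<close>, finitely many since \<open>T\<close> is finite.\<close>

lemma ext_relatively_compact_iff:
  fixes G :: "'g monoid"
  assumes G: "locally_compact_group G X" and Gt: "locally_compact_group (cocycle_extension G T \<alpha>) Xt"
    and T: "comm_group T" "finite (carrier T)" and cocycle: "normalized_cocycle G T \<alpha>"
    and K: "compactin X K" "\<one>\<^bsub>G\<^esub> \<in> X interior_of K"
    and Kt: "compactin Xt (K \<times> {\<one>\<^bsub>T\<^esub>})"
      "\<one>\<^bsub>cocycle_extension G T \<alpha>\<^esub> \<in> Xt interior_of (K \<times> {\<one>\<^bsub>T\<^esub>})"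
    and S: "S \<subseteq> carrier G \<times> carrier T"
  shows "relatively_compact Xt S \<longleftrightarrow> relatively_compact X (fst ` S)"
proof -
  let ?H = "cocycle_extension G T \<alpha>"
  interpret T: comm_group T by fact
  have K_sub: "K \<subseteq> carrier G"
    using compactin_subset_topspace[OF K(1)] G by (simp add: locally_compact_group_def)
  have \<alpha>: "\<alpha> g h \<in> carrier T" if "g \<in> carrier G" "h \<in> carrier G" for g h
    using cocycle that by (simp add: normalized_cocycle_def)
  have "relatively_compact Xt S \<longleftrightarrow> (\<exists>F. finite F \<and> F \<subseteq> carrier ?H \<and>
      S \<subseteq> (\<Union>g\<in>F. g <#\<^bsub>?H\<^esub> (K \<times> {\<one>\<^bsub>T\<^esub>})))"
    by (rule relatively_compact_iff_cosets[OF Gt Kt]) (use S in \<open>simp add: ext_simps\<close>)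
  also have "\<dots> \<longleftrightarrow> (\<exists>F. finite F \<and> F \<subseteq> carrier G \<and> fst ` S \<subseteq> (\<Union>g\<in>F. g <#\<^bsub>G\<^esub> K))"
  proof
    assume "\<exists>F. finite F \<and> F \<subseteq> carrier ?H \<and> S \<subseteq> (\<Union>g\<in>F. g <#\<^bsub>?H\<^esub> (K \<times> {\<one>\<^bsub>T\<^esub>}))"
    then obtain F where F: "finite F" "F \<subseteq> carrier ?H"
      "S \<subseteq> (\<Union>g\<in>F. g <#\<^bsub>?H\<^esub> (K \<times> {\<one>\<^bsub>T\<^esub>}))" by blast
    have "fst ` S \<subseteq> (\<Union>g\<in>fst ` F. g <#\<^bsub>G\<^esub> K)"
    proof
      fix s assume "s \<in> fst ` S"
      then obtain t where "(s, t) \<in> S" by force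
      then obtain f u k where "(f, u) \<in> F" "k \<in> K" "(s, t) = (f, u) \<otimes>\<^bsub>?H\<^esub> (k, \<one>\<^bsub>T\<^esub>)"
        using F(3) by (fastforce simp: l_coset_def)
      then show "s \<in> (\<Union>g\<in>fst ` F. g <#\<^bsub>G\<^esub> K)" by (force simp: ext_simps l_coset_def)
    qed
    moreover have "finite (fst ` F)" "fst ` F \<subseteq> carrier G" using F(1,2) by (auto simp: ext_simps)
    ultimately show "\<exists>F. finite F \<and> F \<subseteq> carrier G \<and> fst ` S \<subseteq> (\<Union>g\<in>F. g <#\<^bsub>G\<^esub> K)" by blast
  next
    assume "\<exists>F. finite F \<and> F \<subseteq> carrier G \<and> fst ` S \<subseteq> (\<Union>g\<in>F. g <#\<^bsub>G\<^esub> K)"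
    then obtain F where F: "finite F" "F \<subseteq> carrier G" "fst ` S \<subseteq> (\<Union>g\<in>F. g <#\<^bsub>G\<^esub> K)" by blast
    have "S \<subseteq> (\<Union>g\<in>F \<times> carrier T. g <#\<^bsub>?H\<^esub> (K \<times> {\<one>\<^bsub>T\<^esub>}))"
    proof
      fix z assume z: "z \<in> S"
      obtain s t where st: "z = (s, t)" by force
      have t: "t \<in> carrier T" using z S st by auto
      have "s \<in> fst ` S" using z st by force
      then obtain f k where fk: "f \<in> F" "k \<in> K" "s = f \<otimes>\<^bsub>G\<^esub> k"
        using F(3) by (auto simp: l_coset_def)
      have \<alpha>fk: "\<alpha> f k \<in> carrier T" using \<alpha> fk F(2) K_sub by blast
      \<comment> \<open>Chosen so that the twist in the product of \<open>(f, u)\<close> and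
        \<open>(k, \<one>)\<close> is cancelled and the second component is
        \<open>t\<close>.\<close>
      define u where "u = inv\<^bsub>T\<^esub> \<alpha> f k \<otimes>\<^bsub>T\<^esub> t"
      have u: "u \<in> carrier T" using \<alpha>fk t by (simp add: u_def)
      have "\<alpha> f k \<otimes>\<^bsub>T\<^esub> u \<otimes>\<^bsub>T\<^esub> \<one>\<^bsub>T\<^esub> = t"
        using \<alpha>fk t by (simp add: u_def T.m_assoc[symmetric])
      then have "z = (f, u) \<otimes>\<^bsub>?H\<^esub> (k, \<one>\<^bsub>T\<^esub>)" by (simp add: st ext_simps fk(3))
      then have "z \<in> (f, u) <#\<^bsub>?H\<^esub> (K \<times> {\<one>\<^bsub>T\<^esub>})" using fk(2) by (auto simp: l_coset_def)
      then show "z \<in> (\<Union>g\<in>F \<times> carrier T. g <#\<^bsub>?H\<^esub> (K \<times> {\<one>\<^bsub>T\<^esub>}))" using fk(1) u by blast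
    qed
    moreover have "finite (F \<times> carrier T)" "F \<times> carrier T \<subseteq> carrier ?H"
      using F(1,2) T(2) by (auto simp: ext_simps)
    ultimately show "\<exists>F. finite F \<and> F \<subseteq> carrier ?H \<and> S \<subseteq> (\<Union>g\<in>F. g <#\<^bsub>?H\<^esub> (K \<times> {\<one>\<^bsub>T\<^esub>}))"
      by blast
  qed
  also have "\<dots> \<longleftrightarrow> relatively_compact X (fst ` S)"
    by (rule relatively_compact_iff_cosets[OF G K, symmetric]) (use S in auto)
  finally show ?thesis .
qed

text \<open>Boundedness in the extension is tested after projection, which carries conjugates by
  \<open>\<gamma> n\<close> to conjugates by \<open>\<delta> n\<close>.\<close>

lemma P_plus_ext:
  fixes G :: "'g monoid"
  assumes G: "locally_compact_group G X" and Gt: "locally_compact_group (cocycle_extension G T \<alpha>) Xt"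
    and T: "comm_group T" "finite (carrier T)" and cocycle: "normalized_cocycle G T \<alpha>"
    and K: "compactin X K" "\<one>\<^bsub>G\<^esub> \<in> X interior_of K"
    and Kt: "compactin Xt (K \<times> {\<one>\<^bsub>T\<^esub>})"
      "\<one>\<^bsub>cocycle_extension G T \<alpha>\<^esub> \<in> Xt interior_of (K \<times> {\<one>\<^bsub>T\<^esub>})"
    and \<gamma>: "\<And>n. n > 0 \<Longrightarrow> \<gamma> n \<in> carrier G \<times> carrier T"
      "\<And>n. n > 0 \<Longrightarrow> fst (\<gamma> n) = \<delta> n"
  shows "P_plus (cocycle_extension G T \<alpha>) Xt \<gamma> = P_plus G X \<delta> \<times> carrier T"
proof -
  let ?H = "cocycle_extension G T \<alpha>"
  have "group G" and "group ?H" using G Gt by (auto simp: locally_compact_group_def)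
  then interpret hom: group_hom ?H G fst by (rule ext_fst_hom)
  have "z \<in> P_plus ?H Xt \<gamma> \<longleftrightarrow> z \<in> P_plus G X \<delta> \<times> carrier T"
    if z: "z \<in> carrier ?H" for z
  proof -
    let ?S = "{inv\<^bsub>?H\<^esub> (\<gamma> n) \<otimes>\<^bsub>?H\<^esub> z \<otimes>\<^bsub>?H\<^esub> \<gamma> n |n. n > 0}"
    have \<gamma>': "\<gamma> n \<in> carrier ?H" if "n > 0" for n using \<gamma>(1)[OF that] by (simp add: ext_simps)
    have "inv\<^bsub>?H\<^esub> (\<gamma> n) \<otimes>\<^bsub>?H\<^esub> z \<otimes>\<^bsub>?H\<^esub> \<gamma> n \<in> carrier ?H" if "n > 0" for n
      using \<gamma>'[OF that] z by simp
    then have S: "?S \<subseteq> carrier G \<times> carrier T" unfolding ext_simps by blast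
    have conj: "fst (inv\<^bsub>?H\<^esub> (\<gamma> n) \<otimes>\<^bsub>?H\<^esub> z \<otimes>\<^bsub>?H\<^esub> \<gamma> n) =
        inv\<^bsub>G\<^esub> (\<delta> n) \<otimes>\<^bsub>G\<^esub> fst z \<otimes>\<^bsub>G\<^esub> \<delta> n" if "n > 0" for n
      using \<gamma>'[OF that] z \<gamma>(2)[OF that] by simp
    have "fst ` ?S = {inv\<^bsub>G\<^esub> (\<delta> n) \<otimes>\<^bsub>G\<^esub> fst z \<otimes>\<^bsub>G\<^esub> \<delta> n |n. n > 0}"
      unfolding setcompr_eq_image image_image using conj by (intro image_cong) auto
    then show ?thesis
      using ext_relatively_compact_iff[OF G Gt T cocycle K Kt S] z
      by (auto simp: P_plus_def ext_simps)
  qed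
  moreover have "P_plus ?H Xt \<gamma> \<subseteq> carrier ?H" "P_plus G X \<delta> \<times> carrier T \<subseteq> carrier ?H"
    by (auto simp: P_plus_def ext_simps)
  ultimately show ?thesis by blast
qed

section \<open>Ends of the extended tree\<close>

text \<open>The inclusion of the core preserves edges, and \<open>fst\<close> retracts onto it by
  collapsing pendant edges; neither map increases distances.\<close>

lemma ext_graph_dist:
  assumes "tree V E" "u \<in> V" "v \<in> V"
  shows "graph_dist (ext_verts V T) (ext_adj V E T) (u, None) (v, None) = graph_dist V E u v"
proof (rule antisym)
  from assms obtain p where p: "walk V E u p v"
    unfolding tree_def connected_graph_def by blast
  have hom: "\<And>y z. E y z \<Longrightarrow> ext_adj V E T (y, None) (z, None)"
    "(\<lambda>v. (v, None)) ` V \<subseteq> ext_verts V T"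
    by (auto simp: ext_adj_def ext_verts_def)
  show "graph_dist (ext_verts V T) (ext_adj V E T) (u, None) (v, None) \<le> graph_dist V E u v"
    by (rule graph_dist_weak_map[OF p]) (use hom in auto)
  have "walk (ext_verts V T) (ext_adj V E T) (u, None) (map (\<lambda>v. (v, None)) p) (v, None)"
    by (rule walk_map[OF p]) (use hom in auto)
  from graph_dist_weak_map[OF this, where f = fst and E' = E and V' = V, unfolded fst_conv]
  show "graph_dist V E u v \<le> graph_dist (ext_verts V T) (ext_adj V E T) (u, None) (v, None)"
    by (simp add: ext_adj_def ext_verts_def) fastforce
qed

lemma ext_geodesic_ray:
  assumes "tree V E" "geodesic_ray V E r"
  shows "geodesic_ray (ext_verts V T) (ext_adj V E T) (\<lambda>n. (r n, None))"
proof -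
  note r_mem = geodesic_ray_mem[OF assms(2)]
  have "range (\<lambda>n. (r n, None)) \<subseteq> ext_verts V T" using r_mem by (auto simp: ext_verts_def)
  then show ?thesis
    using geodesic_ray_dist[OF assms(2)]
    by (simp add: geodesic_ray_def ext_graph_dist[OF assms(1) r_mem r_mem])
qed

lemma ext_cofinal_iff:
  "cofinal_rays (\<lambda>n. (r n, None)) (\<lambda>n. (s n, None)) \<longleftrightarrow> cofinal_rays r s"
  by (simp add: cofinal_rays_def)

text \<open>All representatives in the union defining \<open>ext_end\<close> give the same
  class.\<close>

lemma ext_end_end_of:
  assumes "tree V E" "geodesic_ray V E r"
  shows "ext_end V E T (end_of V E r) =
    end_of (ext_verts V T) (ext_adj V E T) (\<lambda>n. (r n, None))"
proof -
  have "end_of (ext_verts V T) (ext_adj V E T) (\<lambda>n. (s n, None)) =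
      end_of (ext_verts V T) (ext_adj V E T) (\<lambda>n. (r n, None))" if "s \<in> end_of V E r" for s
    using that cofinal_sym
    by (subst end_of_eq_iff) (auto simp: end_of_def ext_cofinal_iff intro: ext_geodesic_ray[OF assms(1)] assms(2))
  moreover have "r \<in> end_of V E r" using assms(2) cofinal_refl by (auto simp: end_of_def)
  ultimately show ?thesis unfolding ext_end_def by blast
qed

lemma ext_adj_iff:
  "ext_adj V E T (u, l) (v, m) \<longleftrightarrow>
    l = None \<and> m = None \<and> E u v \<or>
    u = v \<and> u \<in> V \<and> (l \<in> Some ` carrier T \<and> m = None \<or> l = None \<and> m \<in> Some ` carrier T)"
  by (auto simp: ext_adj_def)

text \<open>This is the shape of the action of each \<open>(g, t)\<close>: an automorphism of the
  base combined with a translation of the leaves over each vertex, which permutes them because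
  \<open>T\<close> is a group.\<close>

lemma fibre_translation_automorphism:
  assumes f: "graph_automorphism V E f" and T: "group T"
    and c: "\<And>v. v \<in> V \<Longrightarrow> c v \<in> carrier T"
  shows "graph_automorphism (ext_verts V T) (ext_adj V E T)
    (\<lambda>(v, l). (f v, map_option (\<lambda>\<rho>. c v \<otimes>\<^bsub>T\<^esub> \<rho>) l))"
proof -
  interpret group T by fact
  let ?f = "\<lambda>(v, l). (f v, map_option (\<lambda>\<rho>. c v \<otimes>\<^bsub>T\<^esub> \<rho>) l)"
  have f_inj: "f u = f v \<longleftrightarrow> u = v" if "u \<in> V" "v \<in> V" for u v
    using f that by (auto simp: graph_automorphism_def bij_betw_def inj_on_def)
  have f_mem: "f v \<in> V" if "v \<in> V" for v
    using f that by (auto simp: graph_automorphism_def bij_betw_def)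
  have f_surj: "\<exists>u\<in>V. f u = v" if "v \<in> V" for v
    using f that by (metis graph_automorphism_def bij_betw_def imageE)
  have f_E: "E (f u) (f v) \<longleftrightarrow> E u v" if "u \<in> V" "v \<in> V" for u v
    using f that by (simp add: graph_automorphism_def)
  have "inj_on ?f (ext_verts V T)"
    using c by (auto simp: inj_on_def ext_verts_def f_inj)
  moreover have "?f ` ext_verts V T = ext_verts V T"
  proof
    show "?f ` ext_verts V T \<subseteq> ext_verts V T" using c f_mem by (auto simp: ext_verts_def)
    show "ext_verts V T \<subseteq> ?f ` ext_verts V T"
    proof
      fix z assume "z \<in> ext_verts V T"
      then obtain v l where z: "z = (v, l)" "v \<in> V" "l = None \<or> (\<exists>\<rho>\<in>carrier T. l = Some \<rho>)"
        by (auto simp: ext_verts_def)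
      obtain u where u: "u \<in> V" "f u = v" using f_surj[OF z(2)] by blast
      \<comment> \<open>The translation to be undone is the one at the preimage \<open>u\<close>,
        not at \<open>v\<close>.\<close>
      let ?l = "map_option (\<lambda>\<rho>. inv\<^bsub>T\<^esub> (c u) \<otimes>\<^bsub>T\<^esub> \<rho>) l"
      have "z = ?f (u, ?l)" using z u c by (auto simp: m_assoc[symmetric])
      moreover have "(u, ?l) \<in> ext_verts V T" using z(3) u c by (auto simp: ext_verts_def)
      ultimately show "z \<in> ?f ` ext_verts V T" by (rule image_eqI)
    qed
  qed
  moreover have "ext_adj V E T (?f y) (?f z) \<longleftrightarrow> ext_adj V E T y z"
    if "y \<in> ext_verts V T" "z \<in> ext_verts V T" for y z
  proof -
    obtain u l v m where yz: "y = (u, l)" "z = (v, m)" by (metis surj_pair)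
    then have "u \<in> V" "v \<in> V" using that by (simp_all add: ext_verts_def)
    then show ?thesis
      using that c by (cases l; cases m) (auto simp: yz ext_adj_iff ext_verts_def f_E f_mem f_inj)
  qed
  ultimately show ?thesis by (simp add: graph_automorphism_def bij_betw_def)
qed

text \<open>The end is represented by a ray in the core, on which \<open>(g, t)\<close> moves
  vertices exactly as \<open>g\<close> does, since \<open>sigma_ext\<close> affects only the
  leaves.\<close>

lemma ext_end_stabilizer:
  fixes G :: "'g monoid"
  assumes tree: "tree V E" and act: "acts_by_automorphisms G V E \<phi>"
    and T: "group T" and cocycle: "normalized_cocycle G T \<alpha>"
    and \<theta>: "vertex_section G V \<phi> x \<theta>" and r: "geodesic_ray V E r"
  shows "stabilizer (cocycle_extension G T \<alpha>) (end_action (ext_action G T \<alpha> \<phi> \<theta>))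
      (ext_end V E T (end_of V E r)) =
    stabilizer G (end_action \<phi>) (end_of V E r) \<times> carrier T"
proof -
  interpret group_action G V \<phi> using act by (simp add: acts_by_automorphisms_def)
  interpret G: group G by (rule group_hom.axioms(1)[OF group_hom])
  interpret T: group T by fact
  have \<alpha>: "\<alpha> g h \<in> carrier T" if "g \<in> carrier G" "h \<in> carrier G" for g h
    using cocycle that by (simp add: normalized_cocycle_def)
  have \<theta>': "\<theta> v \<in> carrier G" if "v \<in> V" for v using \<theta> that by (simp add: vertex_section_def)
  let ?\<psi> = "ext_action G T \<alpha> \<phi> \<theta>"
  have "end_action ?\<psi> (g, t) (ext_end V E T (end_of V E r)) = ext_end V E T (end_of V E r)
      \<longleftrightarrow> end_action \<phi> g (end_of V E r) = end_of V E r"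
    if g: "g \<in> carrier G" and t: "t \<in> carrier T" for g t
  proof -
    have "sigma_ext G T \<alpha> \<phi> \<theta> (g, t) v \<in> carrier T" if v: "v \<in> V" for v
      using \<alpha> \<theta>'[OF v] \<theta>'[OF element_image[OF g v refl]] g t
      by (simp add: sigma_ext_def sigma_def)
    then have "graph_automorphism (ext_verts V T) (ext_adj V E T) (?\<psi> (g, t))"
      using fibre_translation_automorphism[OF action_graph_automorphism[OF act g] T]
      by (simp add: ext_action_def)
    then have "end_action ?\<psi> (g, t) (ext_end V E T (end_of V E r)) = ext_end V E T (end_of V E r)
        \<longleftrightarrow> cofinal_rays (?\<psi> (g, t) \<circ> (\<lambda>n. (r n, None))) (\<lambda>n. (r n, None))"
      unfolding ext_end_end_of[OF tree r]
      by (rule end_action_fixes_iff[where \<phi> = ?\<psi>]) (rule ext_geodesic_ray[OF tree r])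
    also have "?\<psi> (g, t) \<circ> (\<lambda>n. (r n, None)) = (\<lambda>n. ((\<phi> g \<circ> r) n, None))"
      by (auto simp: ext_action_def)
    also have "cofinal_rays \<dots> (\<lambda>n. (r n, None)) \<longleftrightarrow> cofinal_rays (\<phi> g \<circ> r) r"
      by (rule ext_cofinal_iff)
    also have "\<dots> \<longleftrightarrow> end_action \<phi> g (end_of V E r) = end_of V E r"
      by (rule end_action_fixes_iff[where \<phi> = \<phi>, symmetric])
        (use action_graph_automorphism[OF act g] r in auto)
    finally show ?thesis .
  qed
  then show ?thesis by (auto simp: stabilizer_def ext_simps)
qed

section \<open>Parabolic subgroups\<close>

text \<open>The direction is reversed, which the free sign in \<open>translates_line\<close>
  permits; this makes the results for \<open>a\<close> available for its inverse.\<close>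

lemma translates_line_inv:
  assumes act: "acts_by_automorphisms G V E \<phi>" and a: "a \<in> carrier G"
    and L: "geodesic_line V E L" and translates: "translates_line \<phi> a L 1"
  shows "translates_line \<phi> (inv\<^bsub>G\<^esub> a) L 1"
proof -
  interpret group_action G V \<phi> using act by (simp add: acts_by_automorphisms_def)
  interpret group G by (rule group_hom.axioms(1)[OF group_hom])
  have L_mem: "L i \<in> V" for i using L by (auto simp: geodesic_line_def)
  obtain \<epsilon> :: int where \<epsilon>: "\<epsilon> \<in> {1, -1}" and aL: "\<And>i. \<phi> a (L i) = L (i + \<epsilon>)"
    using translates unfolding translates_line_def by fastforce
  have "\<phi> (inv\<^bsub>G\<^esub> a) (L i) = L (i + - \<epsilon>)" for i
  proof -
    have "L i = \<phi> a (L (i + - \<epsilon>))" by (simp add: aL)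
    then have "\<phi> (inv\<^bsub>G\<^esub> a) (L i) = \<phi> (inv\<^bsub>G\<^esub> a \<otimes>\<^bsub>G\<^esub> a) (L (i + - \<epsilon>))"
      using composition_rule[OF L_mem inv_closed[OF a] a] by simp
    then show ?thesis using a one_act[OF L_mem] by simp
  qed
  then show ?thesis using \<epsilon> unfolding translates_line_def by (intro bexI[of _ "- \<epsilon>"]) auto
qed

text \<open>Stated for an arbitrary lift \<open>\<gamma>\<close> of the powers of \<open>a\<close>,
  since it is applied both to \<open>\<beta>t\<close> and, with the inverse of \<open>a\<close>, to
  the inverses of \<open>\<beta>t\<close>, whose components in \<open>T\<close> also involve the
  cocycle.\<close>

lemma attracting_parabolic:
  fixes G :: "'g monoid" and T :: "'t monoid" and \<alpha> :: "'g \<Rightarrow> 'g \<Rightarrow> 't"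
    and \<gamma> :: "nat \<Rightarrow> 'g \<times> 't"
  defines "Gt \<equiv> cocycle_extension G T \<alpha>"
  assumes G: "locally_compact_group G X" and tree: "tree V E"
    and act: "acts_by_automorphisms G V E \<phi>"
    and K: "x \<in> V" "K = stabilizer G \<phi> x" "compactin X K" "openin X K"
    and basis: "neighbourhood_basis X \<one>\<^bsub>G\<^esub> (compact_open_subgroups G X K)"
    and T: "comm_group T" "finite (carrier T)"
    and cocycle: "normalized_cocycle G T \<alpha>" "\<forall>k1\<in>K. \<forall>k2\<in>K. \<alpha> k1 k2 = \<one>\<^bsub>T\<^esub>"
    and Gt: "locally_compact_group Gt Xt"
      "neighbourhood_basis Xt \<one>\<^bsub>Gt\<^esub> {U \<times> {\<one>\<^bsub>T\<^esub>} |U. U \<in> compact_open_subgroups G X K}"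
    and L: "geodesic_line V E L" "x \<in> range L"
    and a: "a \<in> carrier G" "translates_line \<phi> a L 1"
    and \<xi>: "\<xi> \<in> line_endpoints V E L" "attracting_end G V E \<phi> a \<xi>"
    and \<gamma>: "\<And>n. n > 0 \<Longrightarrow> \<gamma> n \<in> carrier G \<times> carrier T"
      "\<And>n. n > 0 \<Longrightarrow> fst (\<gamma> n) = a [^]\<^bsub>G\<^esub> n"
    and \<theta>: "vertex_section G V \<phi> x \<theta>"
  shows "P_plus Gt Xt \<gamma> = P_plus G X (\<lambda>n. a [^]\<^bsub>G\<^esub> n) \<times> carrier T"
    and "P_plus G X (\<lambda>n. a [^]\<^bsub>G\<^esub> n) = stabilizer G (end_action \<phi>) \<xi>"
    and "stabilizer Gt (end_action (ext_action G T \<alpha> \<phi> \<theta>)) (ext_end V E T \<xi>) =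
      stabilizer G (end_action \<phi>) \<xi> \<times> carrier T"
    and "subgroup (P_plus Gt Xt \<gamma>) Gt"
    and "subgroup (U_plus G X (\<lambda>n. a [^]\<^bsub>G\<^esub> n) \<times> carrier T) (Gt\<lparr>carrier := P_plus Gt Xt \<gamma>\<rparr>)"
proof -
  interpret group_action G V \<phi> using act by (simp add: acts_by_automorphisms_def)
  interpret G: group G by (rule group_hom.axioms(1)[OF group_hom])
  interpret T: comm_group T by fact
  interpret Gt: group Gt using Gt(1) by (simp add: locally_compact_group_def)
  obtain i where i: "x = L i" using L(2) by blast
  note ray = attracting_end_eq(1)[OF tree act a(1) L(1) i a(2) \<xi>]
  note \<xi>_eq = attracting_end_eq(2)[OF tree act a(1) L(1) i a(2) \<xi>]
  have sub_K: "subgroup K G"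
    unfolding K(2) using stabilizer_subgroup[OF K(1)] .
  have K_cos: "K \<in> compact_open_subgroups G X K"
    using sub_K K(3,4) by (simp add: compact_open_subgroups_def)
  have one_K: "\<one>\<^bsub>G\<^esub> \<in> X interior_of K"
    using subgroup.one_closed[OF sub_K] K(4) by (simp add: interior_of_openin)
  note Kt = ext_compact_neighbourhood[OF G Gt(1)[unfolded Gt_def] T.is_group K_cos cocycle(2)
      Gt(2)[unfolded Gt_def]]
  show P_ext: "P_plus Gt Xt \<gamma> = P_plus G X (\<lambda>n. a [^]\<^bsub>G\<^esub> n) \<times> carrier T"
    unfolding Gt_def
    by (rule P_plus_ext[OF G Gt(1)[unfolded Gt_def] T cocycle(1) K(3) one_K Kt \<gamma>])
  show P_stab: "P_plus G X (\<lambda>n. a [^]\<^bsub>G\<^esub> n) = stabilizer G (end_action \<phi>) \<xi>"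
    unfolding \<xi>_eq
    by (rule P_plus_eq_end_stabilizer[OF G tree act K(1) _ _ a(1) ray]) (use K in auto)
  show "stabilizer Gt (end_action (ext_action G T \<alpha> \<phi> \<theta>)) (ext_end V E T \<xi>) =
      stabilizer G (end_action \<phi>) \<xi> \<times> carrier T"
    unfolding \<xi>_eq Gt_def
    by (rule ext_end_stabilizer[OF tree act T.is_group cocycle(1) \<theta> ray])
  have preimage: "subgroup (H \<times> carrier T) Gt" if "subgroup H G" for H
    unfolding Gt_def
    by (rule ext_preimage_subgroup[OF G.is_group Gt.is_group[unfolded Gt_def] that])
  have "subgroup (stabilizer G (end_action \<phi>) \<xi>) G"
    unfolding \<xi>_eq by (rule end_stabilizer_subgroup[OF act ray])
  then show sub_P: "subgroup (P_plus Gt Xt \<gamma>) Gt"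
    unfolding P_ext P_stab by (rule preimage)
  have top: "topspace X = carrier G" using G by (simp add: locally_compact_group_def)
  have "subgroup (U_plus G X (\<lambda>n. a [^]\<^bsub>G\<^esub> n)) G"
    by (rule U_plus_subgroup[OF G.is_group basis top])
      (use a(1) in \<open>auto simp: compact_open_subgroups_def\<close>)
  moreover have "U_plus G X (\<lambda>n. a [^]\<^bsub>G\<^esub> n) \<subseteq> P_plus G X (\<lambda>n. a [^]\<^bsub>G\<^esub> n)"
    by (rule U_plus_subset_P_plus[OF G K(3) one_K]) (use a(1) in simp)
  ultimately show "subgroup (U_plus G X (\<lambda>n. a [^]\<^bsub>G\<^esub> n) \<times> carrier T)
      (Gt\<lparr>carrier := P_plus Gt Xt \<gamma>\<rparr>)"
    using Gt.subgroup_incl[OF preimage sub_P] unfolding P_ext by blast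
qed

theorem lemma5p1:
  fixes G :: "'g monoid" and X :: "'g topology"
    and T :: "'t monoid" and \<alpha> :: "'g \<Rightarrow> 'g \<Rightarrow> 't" and Xt :: "('g \<times> 't) topology"
    and V :: "'v set" and E :: "'v \<Rightarrow> 'v \<Rightarrow> bool" and \<phi> :: "'g \<Rightarrow> 'v \<Rightarrow> 'v"
    and x :: 'v and K A :: "'g set" and a :: 'g and L :: "int \<Rightarrow> 'v"
    and \<theta> :: "'v \<Rightarrow> 'g" and \<xi>p \<xi>m :: "(nat \<Rightarrow> 'v) set"
    and \<beta> :: "nat \<Rightarrow> 'g" and t :: "nat \<Rightarrow> 't" and \<beta>t :: "nat \<Rightarrow> 'g \<times> 't"
    and Gt :: "('g \<times> 't) monoid" and \<psi> :: "'g \<times> 't \<Rightarrow> 'v \<times> 't option \<Rightarrow> 'v \<times> 't option"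
  assumes G: "locally_compact_group G X"
    and tree: "tree V E" "locally_finite_graph V E" "infinite V"
    and action: "acts_by_automorphisms G V E \<phi>" "transitive_action G V \<phi>"
    and K: "x \<in> V" "K = stabilizer G \<phi> x" "maximal_compact_subgroup G X K" "openin X K"
    and basis: "neighbourhood_basis X \<one>\<^bsub>G\<^esub> (compact_open_subgroups G X K)"
    and T: "comm_group T" "finite (carrier T)"
    and cocycle: "normalized_cocycle G T \<alpha>" "\<forall>k1\<in>K. \<forall>k2\<in>K. \<alpha> k1 k2 = \<one>\<^bsub>T\<^esub>"
    and Gt: "Gt = cocycle_extension G T \<alpha>" "locally_compact_group Gt Xt"
      "neighbourhood_basis Xt \<one>\<^bsub>Gt\<^esub> {U \<times> {\<one>\<^bsub>T\<^esub>} |U. U \<in> compact_open_subgroups G X K}"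
    and L: "geodesic_line V E L" "x \<in> range L"
    and a: "a \<in> carrier G" "\<phi> a ` range L = range L" "translates_line \<phi> a L 1"
    and A: "A = {a [^]\<^bsub>G\<^esub> n |n :: int. True}"
    and KAK: "carrier G = K <#>\<^bsub>G\<^esub> A <#>\<^bsub>G\<^esub> K"
    and \<xi>: "{\<xi>p, \<xi>m} = line_endpoints V E L"
      "attracting_end G V E \<phi> a \<xi>p" "repelling_end G V E \<phi> a \<xi>m"
    and \<beta>: "\<beta> = (\<lambda>n. a [^]\<^bsub>G\<^esub> n)"
    and \<beta>t: "\<forall>n>0. t n \<in> carrier T" "\<beta>t = (\<lambda>n. (a [^]\<^bsub>G\<^esub> n, t n))"
    and \<theta>: "vertex_section G V \<phi> x \<theta>"
    and \<psi>: "\<psi> = ext_action G T \<alpha> \<phi> \<theta>"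
  shows "(P_plus Gt Xt \<beta>t = P_plus G X \<beta> \<times> carrier T \<and>
      P_plus G X \<beta> \<times> carrier T = stabilizer Gt (end_action \<psi>) (ext_end V E T \<xi>p) \<and>
      stabilizer Gt (end_action \<psi>) (ext_end V E T \<xi>p)
        = stabilizer G (end_action \<phi>) \<xi>p \<times> carrier T \<and>
      stabilizer G (end_action \<phi>) \<xi>p \<times> carrier T \<subseteq> carrier Gt) \<and>
    (P_minus Gt Xt \<beta>t = P_minus G X \<beta> \<times> carrier T \<and>
      P_minus G X \<beta> \<times> carrier T = stabilizer Gt (end_action \<psi>) (ext_end V E T \<xi>m) \<and>
      stabilizer Gt (end_action \<psi>) (ext_end V E T \<xi>m)
        = stabilizer G (end_action \<phi>) \<xi>m \<times> carrier T \<and>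
      stabilizer G (end_action \<phi>) \<xi>m \<times> carrier T \<subseteq> carrier Gt) \<and>
    (subgroup (P_plus Gt Xt \<beta>t) Gt \<and>
      subgroup (U_plus G X \<beta> \<times> carrier T) (Gt\<lparr>carrier := P_plus Gt Xt \<beta>t\<rparr>)) \<and>
    (subgroup (P_minus Gt Xt \<beta>t) Gt \<and>
      subgroup (U_minus G X \<beta> \<times> carrier T) (Gt\<lparr>carrier := P_minus Gt Xt \<beta>t\<rparr>))"
proof -
  interpret G: group G using G by (simp add: locally_compact_group_def)
  interpret Gt: group Gt using Gt(2) by (simp add: locally_compact_group_def)
  interpret T: comm_group T by fact
  have K': "compactin X K" using K(3) by (simp add: maximal_compact_subgroup_def)
  have ends: "\<xi>p \<in> line_endpoints V E L" "\<xi>m \<in> line_endpoints V E L"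
    using \<xi>(1) by blast+
  have \<beta>t_mem: "\<beta>t n \<in> carrier Gt" if "n > 0" for n
    using \<beta>t that a(1) by (simp add: Gt(1) ext_simps)
  have \<beta>t_fst: "fst (\<beta>t n) = a [^]\<^bsub>G\<^esub> n" for n by (simp add: \<beta>t(2))
  \<comment> \<open>The inverted lift is again a lift, now of the powers of the inverse of
    \<open>a\<close>.\<close>
  have \<beta>t_inv_fst: "fst (inv\<^bsub>Gt\<^esub> (\<beta>t n)) = (inv\<^bsub>G\<^esub> a) [^]\<^bsub>G\<^esub> n" if "n > 0" for n
    using group_hom.hom_inv[OF ext_fst_hom[OF G.is_group Gt.is_group[unfolded Gt(1)]],
        of "\<beta>t n"] \<beta>t_mem[OF that] \<beta>t_fst[of n] a(1)
    by (simp add: Gt(1) G.nat_pow_inv)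
  have minus: "P_minus G X \<beta> = P_plus G X (\<lambda>n. (inv\<^bsub>G\<^esub> a) [^]\<^bsub>G\<^esub> n)"
    "U_minus G X \<beta> = U_plus G X (\<lambda>n. (inv\<^bsub>G\<^esub> a) [^]\<^bsub>G\<^esub> n)"
    "P_minus Gt Xt \<beta>t = P_plus Gt Xt (\<lambda>n. inv\<^bsub>Gt\<^esub> (\<beta>t n))"
    using P_minus_eq_P_plus[OF G.is_group, of \<beta>] U_minus_eq_U_plus[OF G.is_group, of \<beta>]
      P_minus_eq_P_plus[OF Gt.is_group, of \<beta>t] \<beta>t_mem a(1)
    by (simp_all add: \<beta> G.nat_pow_inv)
  note setting = G tree(1) action(1) K(1,2) K' K(4) basis T cocycle Gt(2,3)[unfolded Gt(1)] L
  note plus = attracting_parabolic[OF setting a(1,3) ends(1) \<xi>(2) _ _ \<theta>, of \<beta>t,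
      folded Gt(1) \<psi> \<beta>]
  \<comment> \<open>A repelling end of \<open>a\<close> is by definition attracting for its inverse,
    so the same result covers the minus side.\<close>
  note minus' = attracting_parabolic[OF setting G.inv_closed[OF a(1)]
      translates_line_inv[OF action(1) a(1) L(1) a(3)] ends(2)
      \<xi>(3)[unfolded repelling_end_def] _ _ \<theta>, of "\<lambda>n. inv\<^bsub>Gt\<^esub> (\<beta>t n)",
      folded Gt(1) \<psi> minus]
  have mem: "\<beta>t n \<in> carrier G \<times> carrier T" "inv\<^bsub>Gt\<^esub> (\<beta>t n) \<in> carrier G \<times> carrier T" if "n > 0" for n
    using \<beta>t_mem[OF that] Gt.inv_closed[OF \<beta>t_mem[OF that]] by (simp_all add: Gt(1) ext_simps)
  have \<beta>t_fst': "fst (\<beta>t n) = \<beta> n" for n by (simp add: \<beta>t(2) \<beta>)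
  have sub: "stabilizer G (end_action \<phi>) \<xi> \<times> carrier T \<subseteq> carrier Gt" for \<xi>
    by (auto simp: stabilizer_def Gt(1) ext_simps)
  show ?thesis
    using plus[OF mem(1) \<beta>t_fst'] minus'[OF mem(2) \<beta>t_inv_fst] sub by (simp add: minus(3))
qed

end
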